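(* Let $(S(t))_{t\ge 0}$ be a convex monotone semigroup on $C_\kappa$ with upper Lipschitz set $\mathcal L_S^+$ and upper $\Gamma$-generator $A_\Gamma^+$, and let $f\in\mathcal L_S^+$. Let $0\le T_1\le T_2$ and let $u\colon[T_1,T_2]\to\mathcal L_S^+$ be a function with $S(T_1)f\le u(T_1)$, $\sup_{t\in[T_1,T_2]}\|u(t)\|_\kappa<\infty$ and $\Gamma\text{-}\limsup_{s\to t}u(s)\le u(t)$ for all $t\in[T_1,T_2]$ (with $s\in[T_1,T_2]$). Suppose that, for every $t\in[T_1,T_2)$, $$\limsup_{h\downarrow 0}\Big\|\Big(\frac{u(t+h)-u(t)}{h}\Big)^-\Big\|_\kappa<\infty\quad\text{and}\quad \Gamma\text{-}\limsup_{h\downarrow 0}\Big(A_\Gamma^+u(t)-\frac{u(t+h)-u(t)}{h}\Big)\le 0.$$ Then $S(t)f\le u(t)$ for all $t\in[T_1,T_2]$.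
   Context: $(X,d)$ is a complete separable metric space and $\kappa\colon X\to(0,\infty)$ is bounded and continuous. Functions are ordered pointwise, $f^+=\max\{f,0\}$, $f^-=-\min\{f,0\}$, and $\|f\|_\kappa:=\sup_{x\in X}|f(x)|\kappa(x)\in[0,\infty]$. $C_\kappa$ is the space of continuous $f\colon X\to\mathbb R$ with $\|f\|_\kappa<\infty$; $U_\kappa$ is the set of upper semicontinuous $f\colon X\to[-\infty,\infty)$ with $\|f^+\|_\kappa<\infty$. A set $F\subset U_\kappa$ is bounded above if $\sup_{f\in F}\|f^+\|_\kappa<\infty$. $\Gamma$-limits: for $(f_n)\subset U_\kappa$ bounded above, $(\Gamma\text{-}\limsup_{n\to\infty}f_n)(x):=\sup\{\limsup_n f_n(x_n): x_n\to x\}$. For families, $\Gamma\text{-}\limsup_{s\to t}f_s$ is the pointwise supremum of $\Gamma\text{-}\limsup_n f_{s_n}$ over all admissible sequences $s_n\to t$ (with $s_n\ge 0$); $\Gamma\text{-}\limsup_{h\downarrow 0}$ is the same with sequences $h_n>0$, $h_n\to0$. (The family only has to be bounded above near the limit point.) A convex monotone semigroup on $C_\kappa$ is a family of operators $S(t)\colon C_\kappa\to C_\kappa$, $t\ge0$, such that: (S1) each $S(t)$ is convex ($S(t)(\lambda f+(1-\lambda)g)\le\lambda S(t)f+(1-\lambda)S(t)g$ for $\lambda\in[0,1]$), monotone ($f\le g$ implies $S(t)f\le S(t)g$), and $S(t)f_n\downarrow0$ pointwise whenever $(f_n)\subset C_\kappa$ decreases pointwise to $0$; (S2) $S(0)f=f$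 and $S(s+t)f=S(s)S(t)f$; (S3) $\sup_{t\in[0,T]}\|S(t)\frac r\kappa\|_\kappa<\infty$ for all $r,T\ge0$; (S4) $\Gamma\text{-}\limsup_{s\to t}S(s)f\le S(t)f$ for all $t\ge0$, $f\in C_\kappa$. Upper Lipschitz set: $\mathcal L_S^+$ is the set of $f\in C_\kappa$ with $\limsup_{h\downarrow0}\big\|\frac{(S(h)f-f)^+}{h}\big\|_\kappa<\infty$. Upper $\Gamma$-generator: $A_\Gamma^+\colon\mathcal L_S^+\to U_\kappa$, $A_\Gamma^+f:=\Gamma\text{-}\limsup_{h\downarrow0}\frac{S(h)f-f}{h}$. *)

theory Defs
  imports "HOL-Analysis.Analysis"
begin

definition pos_part :: "('a \<Rightarrow> 'b::{linorder,zero}) \<Rightarrow> 'a \<Rightarrow> 'b" where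
  "pos_part f = (\<lambda>x. max (f x) 0)"

definition neg_part :: "('a \<Rightarrow> 'b::{linorder,zero,uminus}) \<Rightarrow> 'a \<Rightarrow> 'b" where
  "neg_part f = (\<lambda>x. - min (f x) 0)"

definition wnorm :: "('a \<Rightarrow> real) \<Rightarrow> ('a \<Rightarrow> real) \<Rightarrow> ereal" where
  "wnorm \<kappa> f = (SUP x. ereal (\<bar>f x\<bar> * \<kappa> x))"

definition C_space :: "('a::topological_space \<Rightarrow> real) \<Rightarrow> ('a \<Rightarrow> real) set" where
  "C_space \<kappa> = {f. continuous_on UNIV f \<and> wnorm \<kappa> f < \<infinity>}"

(* Since f < \<infinity> is required, real_of_ereal loses nothing on the positive part. *)
definition U_space :: "('a::topological_space \<Rightarrow> real) \<Rightarrow> ('a \<Rightarrow> ereal) set" where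
  "U_space \<kappa> = {f. (\<forall>a. open {x. f x < a}) \<and> (\<forall>x. f x < \<infinity>)
     \<and> wnorm \<kappa> (\<lambda>x. real_of_ereal (pos_part f x)) < \<infinity>}"

definition Gamma_limsup :: "(nat \<Rightarrow> 'a::topological_space \<Rightarrow> ereal) \<Rightarrow> 'a \<Rightarrow> ereal" where
  "Gamma_limsup F = (\<lambda>x. SUP y \<in> {y. y \<longlonglongrightarrow> x}. limsup (\<lambda>n. F n (y n)))"

(* The \<Gamma>-limsup of a family (F s) as s \<rightarrow> t, where I is the set of admissible parameters.
   Sequences may hit t itself if t \<in> I. *)
definition Gamma_Limsup ::
    "real set \<Rightarrow> real \<Rightarrow> (real \<Rightarrow> 'a::topological_space \<Rightarrow> ereal) \<Rightarrow> 'a \<Rightarrow> ereal" where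
  "Gamma_Limsup I t F =
     (\<lambda>x. SUP s \<in> {s. (\<forall>n. s n \<in> I) \<and> s \<longlonglongrightarrow> t}. Gamma_limsup (\<lambda>n. F (s n)) x)"

(* S acts on all functions, but only its restriction to C_space is constrained. *)
definition convex_monotone_semigroup ::
    "('a::topological_space \<Rightarrow> real) \<Rightarrow> (real \<Rightarrow> ('a \<Rightarrow> real) \<Rightarrow> ('a \<Rightarrow> real)) \<Rightarrow> bool" where
  "convex_monotone_semigroup \<kappa> S \<longleftrightarrow>
     (\<forall>t\<ge>0. \<forall>f\<in>C_space \<kappa>. S t f \<in> C_space \<kappa>) \<and>
     (\<forall>t\<ge>0. \<forall>f\<in>C_space \<kappa>. \<forall>g\<in>C_space \<kappa>. \<forall>l\<in>{0..1}.
        S t (\<lambda>x. l * f x + (1 - l) * g x) \<le> (\<lambda>x. l * S t f x + (1 - l) * S t g x)) \<and>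
     (\<forall>t\<ge>0. \<forall>f\<in>C_space \<kappa>. \<forall>g\<in>C_space \<kappa>. f \<le> g \<longrightarrow> S t f \<le> S t g) \<and>
     (\<forall>t\<ge>0. \<forall>F. (\<forall>n::nat. F n \<in> C_space \<kappa>) \<longrightarrow> decseq F \<longrightarrow> (\<forall>x. (\<lambda>n. F n x) \<longlonglongrightarrow> 0)
        \<longrightarrow> decseq (\<lambda>n. S t (F n)) \<and> (\<forall>x. (\<lambda>n. S t (F n) x) \<longlonglongrightarrow> 0)) \<and>
     (\<forall>f\<in>C_space \<kappa>. S 0 f = f) \<and>
     (\<forall>s\<ge>0. \<forall>t\<ge>0. \<forall>f\<in>C_space \<kappa>. S (s + t) f = S s (S t f)) \<and>
     (\<forall>r\<ge>0. \<forall>T\<ge>0. (SUP t\<in>{0..T}. wnorm \<kappa> (S t (\<lambda>x. r / \<kappa> x))) < \<infinity>) \<and>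
     (\<forall>t\<ge>0. \<forall>f\<in>C_space \<kappa>.
        Gamma_Limsup {0..} t (\<lambda>s x. ereal (S s f x)) \<le> (\<lambda>x. ereal (S t f x)))"

definition upper_Lipschitz_set ::
    "('a::topological_space \<Rightarrow> real) \<Rightarrow> (real \<Rightarrow> ('a \<Rightarrow> real) \<Rightarrow> ('a \<Rightarrow> real)) \<Rightarrow> ('a \<Rightarrow> real) set" where
  "upper_Lipschitz_set \<kappa> S = {f \<in> C_space \<kappa>.
     Limsup (at_right 0) (\<lambda>h. wnorm \<kappa> (\<lambda>x. pos_part (\<lambda>y. S h f y - f y) x / h)) < \<infinity>}"

definition upper_Gamma_generator ::
    "(real \<Rightarrow> ('a::topological_space \<Rightarrow> real) \<Rightarrow> ('a \<Rightarrow> real)) \<Rightarrow> ('a \<Rightarrow> real) \<Rightarrow> 'a \<Rightarrow> ereal" where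
  "upper_Gamma_generator S f =
     Gamma_Limsup {0<..} 0 (\<lambda>h x. ereal ((S h f x - f x) / h))"

(* The rest shows that the upper generator indeed maps the upper Lipschitz set into U_space. *)

lemma Gamma_Limsup_ge:
  assumes "\<And>n. s n \<in> I" "s \<longlonglongrightarrow> t" "y \<longlonglongrightarrow> x"
  shows "limsup (\<lambda>n. F (s n) (y n)) \<le> Gamma_Limsup I t F x"
proof -
  have "limsup (\<lambda>n. F (s n) (y n)) \<le> Gamma_limsup (\<lambda>n. F (s n)) x"
    unfolding Gamma_limsup_def using assms by (intro SUP_upper2[where i=y]) auto
  also have "\<dots> \<le> Gamma_Limsup I t F x"
    unfolding Gamma_Limsup_def using assms by (intro SUP_upper) auto
  finally show ?thesis .
qed

lemma less_Gamma_LimsupD: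
  assumes "b < Gamma_Limsup I t F x"
  obtains s y where "\<And>n. s n \<in> I" "s \<longlonglongrightarrow> t" "y \<longlonglongrightarrow> x" "b < limsup (\<lambda>n. F (s n) (y n))"
  using assms unfolding Gamma_Limsup_def Gamma_limsup_def less_SUP_iff by blast

lemma Gamma_Limsup_near:
  fixes F :: "real \<Rightarrow> 'a::metric_space \<Rightarrow> ereal"
  assumes "b < Gamma_Limsup I t F x" "e > 0"
  shows "\<exists>s z. s \<in> I \<and> dist s t < e \<and> dist z x < e \<and> b < F s z"
proof -
  obtain s y where sy: "\<And>n. s n \<in> I" "s \<longlonglongrightarrow> t" "y \<longlonglongrightarrow> x"
      and b: "b < limsup (\<lambda>n. F (s n) (y n))"
    using less_Gamma_LimsupD[OF assms(1)] by blast
  have "\<exists>\<^sub>F n in sequentially. b < F (s n) (y n)"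
  proof (rule ccontr)
    assume "\<not> ?thesis"
    then have "limsup (\<lambda>n. F (s n) (y n)) \<le> b"
      by (intro Limsup_bounded) (auto simp: frequently_def not_less)
    with b show False by simp
  qed
  moreover have "\<forall>\<^sub>F n in sequentially. dist (s n) t < e" "\<forall>\<^sub>F n in sequentially. dist (y n) x < e"
    using sy assms(2) by (auto intro: tendstoD)
  ultimately have "\<exists>\<^sub>F n in sequentially. b < F (s n) (y n) \<and> dist (s n) t < e \<and> dist (y n) x < e"
    by (intro frequently_eventually_frequently eventually_conj)
  then show ?thesis using sy(1) by (auto dest!: frequently_ex)
qed

lemma Gamma_Limsup_usc:
  fixes F :: "real \<Rightarrow> 'a::metric_space \<Rightarrow> ereal"
  shows "open {x. Gamma_Limsup I t F x < a}"
proof -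
  have "closed {x. a \<le> Gamma_Limsup I t F x}"
  proof (unfold closed_sequential_limits, intro allI impI, elim conjE)
    fix y x assume y: "\<forall>n. y n \<in> {x. a \<le> Gamma_Limsup I t F x}" "y \<longlonglongrightarrow> x"
    have "b \<le> Gamma_Limsup I t F x" if "b < a" for b
    proof -
      have "\<forall>n. \<exists>s z. s \<in> I \<and> dist s t < inverse (real (Suc n)) \<and>
          dist z (y n) < inverse (real (Suc n)) \<and> b < F s z"
        using y(1) that by (intro allI Gamma_Limsup_near) (auto intro: less_le_trans)
      then obtain s z where sz: "\<And>n. s n \<in> I" "\<And>n. dist (s n) t < inverse (real (Suc n))"
          "\<And>n. dist (z n) (y n) < inverse (real (Suc n))" "\<And>n. b < F (s n) (z n)"
        by metis
      have s: "s \<longlonglongrightarrow> t"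
        unfolding tendsto_dist_iff[of s]
        by (rule tendsto_sandwich[OF _ _ tendsto_const LIMSEQ_inverse_real_of_nat])
           (intro always_eventually allI less_imp_le sz(2) zero_le_dist)+
      have "(\<lambda>n. dist (z n) (y n)) \<longlonglongrightarrow> 0"
        by (rule tendsto_sandwich[OF _ _ tendsto_const LIMSEQ_inverse_real_of_nat])
           (intro always_eventually allI less_imp_le sz(3) zero_le_dist)+
      moreover have "(\<lambda>n. dist (y n) x) \<longlonglongrightarrow> 0"
        using y(2) by (simp add: tendsto_dist_iff[symmetric])
      ultimately have sum: "(\<lambda>n. dist (z n) (y n) + dist (y n) x) \<longlonglongrightarrow> 0"
        using tendsto_add by fastforce
      have z: "z \<longlonglongrightarrow> x"
        unfolding tendsto_dist_iff[of z]
        by (rule tendsto_sandwich[OF _ _ tendsto_const sum])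
           (intro always_eventually allI dist_triangle zero_le_dist)+
      have "b \<le> limsup (\<lambda>n. F (s n) (z n))"
        using sz(4) by (intro le_Limsup always_eventually allI less_imp_le) auto
      also have "\<dots> \<le> Gamma_Limsup I t F x"
        by (rule Gamma_Limsup_ge) (use s z sz(1) in auto)
      finally show ?thesis .
    qed
    then show "x \<in> {x. a \<le> Gamma_Limsup I t F x}"
      by (auto intro: dense_ge dense_le)
  qed
  then have "open (- {x. a \<le> Gamma_Limsup I t F x})" by (rule open_Compl)
  also have "- {x. a \<le> Gamma_Limsup I t F x} = {x. Gamma_Limsup I t F x < a}" by auto
  finally show ?thesis .
qed

lemma upper_Gamma_generator_in_U_space:
  fixes \<kappa> :: "'a::metric_space \<Rightarrow> real"
  assumes "continuous_on UNIV \<kappa>" "\<And>x. 0 < \<kappa> x" "f \<in> upper_Lipschitz_set \<kappa> S"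
  shows "upper_Gamma_generator S f \<in> U_space \<kappa>"
proof -
  let ?q = "\<lambda>h x. pos_part (\<lambda>y. S h f y - f y) x / h"
  from assms(3) have "Limsup (at_right 0) (\<lambda>h. wnorm \<kappa> (?q h)) < \<infinity>"
    by (simp add: upper_Lipschitz_set_def)
  then obtain c where c: "Limsup (at_right 0) (\<lambda>h. wnorm \<kappa> (?q h)) < ereal c"
    using less_PInf_Ex_of_nat by auto
  then have ev: "\<forall>\<^sub>F h in at_right 0. wnorm \<kappa> (?q h) < ereal c"
    by (rule Limsup_lessD)
  have "(0::ereal) \<le> wnorm \<kappa> (?q h)" for h
    unfolding wnorm_def
    by (rule SUP_upper2[of undefined]) (auto simp: assms(2) less_imp_le)
  moreover obtain h0 where "wnorm \<kappa> (?q h0) < ereal c"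
    using eventually_happens[OF ev] by auto
  ultimately have c0: "0 \<le> c" by (metis ereal_less_eq(5) le_less_trans less_imp_le)
  have bound: "upper_Gamma_generator S f x \<le> ereal (c / \<kappa> x)" for x
  proof (rule ccontr)
    assume "\<not> ?thesis"
    then obtain s y where sy: "\<And>n::nat. s n \<in> {0<..}" "s \<longlonglongrightarrow> 0" "y \<longlonglongrightarrow> x"
        and lt: "ereal (c / \<kappa> x) < limsup (\<lambda>n. ereal ((S (s n) f (y n) - f (y n)) / s n))"
      unfolding upper_Gamma_generator_def not_le by (rule less_Gamma_LimsupD) auto
    have "filterlim s (at_right 0) sequentially"
      using sy(1,2) by (auto simp: filterlim_at intro!: always_eventually less_imp_neq[THEN not_sym])
    then have evn: "\<forall>\<^sub>F n in sequentially. wnorm \<kappa> (?q (s n)) < ereal c"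
      using ev by (rule eventually_compose_filterlim[rotated])
    have "\<forall>\<^sub>F n in sequentially. ereal ((S (s n) f (y n) - f (y n)) / s n) \<le> ereal (c / \<kappa> (y n))"
      using evn
    proof eventually_elim
      case (elim n)
      have "ereal (\<bar>?q (s n) (y n)\<bar> * \<kappa> (y n)) \<le> wnorm \<kappa> (?q (s n))"
        unfolding wnorm_def by (rule SUP_upper) simp
      with elim have "ereal (\<bar>?q (s n) (y n)\<bar> * \<kappa> (y n)) < ereal c" by (rule le_less_trans[rotated])
      then have 1: "\<bar>?q (s n) (y n)\<bar> \<le> c / \<kappa> (y n)"
        using assms(2)[of "y n"] by (simp add: pos_le_divide_eq)
      have "(S (s n) f (y n) - f (y n)) / s n \<le> ?q (s n) (y n)"
        using sy(1)[of n] by (auto simp: pos_part_def intro!: divide_right_mono)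
      from order_trans[OF this order_trans[OF abs_ge_self 1]] show ?case by simp
    qed
    then have "limsup (\<lambda>n. ereal ((S (s n) f (y n) - f (y n)) / s n)) \<le> limsup (\<lambda>n. ereal (c / \<kappa> (y n)))"
      by (rule Limsup_mono)
    also have "\<dots> = ereal (c / \<kappa> x)"
    proof (rule lim_imp_Limsup)
      have "(\<lambda>n. \<kappa> (y n)) \<longlonglongrightarrow> \<kappa> x"
        using assms(1) sy(3) by (auto simp: continuous_on_def intro: tendsto_compose)
      then show "(\<lambda>n. ereal (c / \<kappa> (y n))) \<longlonglongrightarrow> ereal (c / \<kappa> x)"
        using assms(2)[of x] by (auto intro!: tendsto_intros)
    qed simp
    finally show False using lt by simp
  qed
  have "\<bar>real_of_ereal (pos_part (upper_Gamma_generator S f) x)\<bar> * \<kappa> x \<le> c" for x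
  proof -
    have "pos_part (upper_Gamma_generator S f) x \<le> ereal (c / \<kappa> x)"
      using bound[of x] c0 assms(2)[of x] by (simp add: pos_part_def)
    moreover have "0 \<le> pos_part (upper_Gamma_generator S f) x"
      by (simp add: pos_part_def)
    ultimately have "\<bar>real_of_ereal (pos_part (upper_Gamma_generator S f) x)\<bar> \<le> c / \<kappa> x"
      by (cases "pos_part (upper_Gamma_generator S f) x") auto
    then show ?thesis using assms(2)[of x] by (simp add: pos_le_divide_eq)
  qed
  then have "wnorm \<kappa> (\<lambda>x. real_of_ereal (pos_part (upper_Gamma_generator S f) x)) \<le> ereal c"
    unfolding wnorm_def by (intro SUP_least) simp
  then have "wnorm \<kappa> (\<lambda>x. real_of_ereal (pos_part (upper_Gamma_generator S f) x)) < \<infinity>"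
    by (rule le_less_trans) simp
  moreover have "upper_Gamma_generator S f x < \<infinity>" for x
    using bound[of x] by (rule le_less_trans) simp
  moreover have "open {x. upper_Gamma_generator S f x < a}" for a
    unfolding upper_Gamma_generator_def by (rule Gamma_Limsup_usc)
  ultimately show ?thesis by (simp add: U_space_def)
qed

end

theory Submission
  imports Defs
begin

text \<open>
  Fix a time \<open>T\<close> and a point \<open>x\<close>, and put \<open>v s = S (T - s) (u s) x\<close> for \<open>s\<close> in \<open>[T1, T]\<close>. Since
  \<open>v T1 \<ge> S T f x\<close> and \<open>v T = u T x\<close>, the claim follows once \<open>v\<close> is known not to drop below its
  initial value. The function \<open>v\<close> is upper semicontinuous, so it suffices that its upper right
  Dini derivative is nonnegative before \<open>T\<close>: for every \<open>\<delta> > 0\<close> some, not necessarily all, small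
  \<open>h > 0\<close> satisfy \<open>v (s + h) \<ge> v s - \<delta> * h\<close> (\<open>upper_right_derivative_nonneg\<close>, with
  \<open>le_by_right_steps\<close>).

  Let \<open>g = u s\<close>, and let \<open>A\<close> be the upper generator. The bounds for \<open>(S h g - g) / h\<close> and for
  \<open>A g - (u (s + h) - g) / h\<close> cannot simply be added to compare \<open>S h g\<close> with \<open>u (s + h)\<close>,
  because \<open>A g\<close> is only upper semicontinuous: along \<open>y n \<longlonglongrightarrow> x\<close> the quotients
  \<open>(S (h n) g - g) / h n\<close> at \<open>y n\<close> are bounded by \<open>A g x\<close> and not by \<open>A g (y n)\<close>. Instead \<open>A g\<close> is
  compared with \<open>u (s + h)\<close> at a fixed \<open>h\<close>, and the semigroup is moved by an independent step
  \<open>\<epsilon>\<close> tending to \<open>0\<close>. Let \<open>\<tau> = T - s\<close> and \<open>p h = S (\<tau> - h) g x\<close>. Convexity bounds the decrease of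
  \<open>p\<close> at \<open>h\<close> by the secant
  \<open>(p h - p (h + \<epsilon>)) / \<epsilon> \<le> (S (\<tau> - h - \<epsilon>) (g + h * (S \<epsilon> g - g) / \<epsilon>) x - p (h + \<epsilon>)) / h\<close>,
  whose limit superior as \<open>\<epsilon> \<rightarrow> 0\<close> is at most \<open>(S (\<tau> - h) G x - p h) / h\<close> for every \<open>G\<close> in \<open>C_space \<kappa>\<close>
  with \<open>G \<ge> g + h * A g\<close> (\<open>orbit_left_derivative\<close>). The assumption on \<open>u\<close> provides such a
  \<open>G = u (s + h) + h * E N\<close> with continuous \<open>E n\<close> decreasing to \<open>0\<close> (\<open>generator_envelope\<close>), and the
  correction \<open>h * E N\<close> costs only \<open>h * \<delta> / 4\<close> (\<open>S_perturbation\<close>).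

  Suppose now that \<open>v (s + h) < v s - \<delta> * h\<close> for all small \<open>h\<close>. The mean decrease
  \<open>q h = (p 0 - p h) / h\<close> then bounds the pointwise one strictly:
  \<open>(p h - p (h + \<epsilon>)) / \<epsilon> \<le> q h - \<delta> / 2\<close> for small \<open>\<epsilon>\<close>. So \<open>q\<close> loses at least \<open>\<delta> / 4\<close> whenever its
  argument doubles, and \<open>q (m / 2 ^ n)\<close> tends to infinity. But \<open>q\<close> is bounded above, as \<open>g\<close> lies in the
  upper Lipschitz set.
\<close>

section \<open>Real functions that never step down to the right\<close>

text \<open>
  Upper semicontinuity keeps the set where \<open>\<phi> \<ge> \<phi> a\<close> closed under increasing limits, so it
  contains its supremum; a further step to the right shows that this supremum is \<open>b\<close>.
\<close>

lemma le_by_right_steps: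
  fixes \<phi> :: "real \<Rightarrow> real"
  assumes "a \<le> b"
    and usc: "\<And>s y. s \<in> {a..b} \<Longrightarrow> \<phi> s < y \<Longrightarrow> \<forall>\<^sub>F r in at s within {a..b}. \<phi> r < y"
    and step: "\<And>s. s \<in> {a..<b} \<Longrightarrow> \<exists>h>0. s + h \<le> b \<and> \<phi> s \<le> \<phi> (s + h)"
  shows "\<phi> a \<le> \<phi> b"
proof -
  define M where "M = {s \<in> {a..b}. \<phi> a \<le> \<phi> s}"
  define c where "c = Sup M"
  have "a \<in> M" using \<open>a \<le> b\<close> by (simp add: M_def)
  have bdd: "bdd_above M" by (rule bdd_aboveI[of _ b]) (simp add: M_def)
  have c: "a \<le> c" "c \<le> b"
    unfolding c_def using \<open>a \<in> M\<close> bdd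
    by (auto intro!: cSup_upper cSup_least simp: M_def)
  have "c \<in> M"
  proof (rule ccontr)
    assume "c \<notin> M"
    then have "\<phi> c < \<phi> a" using c by (simp add: M_def not_le)
    then obtain d where d: "d > 0"
      "\<And>r. r \<in> {a..b} \<Longrightarrow> r \<noteq> c \<Longrightarrow> dist r c < d \<Longrightarrow> \<phi> r < \<phi> a"
      using usc[of c "\<phi> a"] c unfolding eventually_at by auto
    obtain r where r: "r \<in> M" "c - d < r"
      using less_cSup_iff[of M "c - d"] \<open>a \<in> M\<close> bdd \<open>d > 0\<close> by (auto simp: c_def)
    have "r \<le> c" using r bdd by (simp add: c_def cSup_upper)
    with r have "dist r c < d" by (simp add: dist_real_def)
    with d(2)[of r] r \<open>c \<notin> M\<close> show False by (auto simp: M_def)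
  qed
  have "c = b"
  proof (rule ccontr)
    assume "c \<noteq> b"
    with c step[of c] obtain h where h: "h > 0" "c + h \<le> b" "\<phi> c \<le> \<phi> (c + h)" by auto
    with \<open>c \<in> M\<close> have "c + h \<in> M" by (auto simp: M_def)
    then have "c + h \<le> c" using bdd unfolding c_def by (rule cSup_upper)
    with h show False by simp
  qed
  with \<open>c \<in> M\<close> show ?thesis by (simp add: M_def)
qed

section \<open>\<open>\<Gamma>\<close>-limits and weighted norms\<close>

text \<open>
  A strict upper bound for the \<open>\<Gamma>\<close>-limit holds uniformly near the limit point. All later
  arguments use \<open>\<Gamma>\<close>-limits in this form, without sequences.
\<close>

lemma Gamma_Limsup_lessD:
  fixes F :: "real \<Rightarrow> 'a::metric_space \<Rightarrow> ereal"
  assumes "Gamma_Limsup I t F x < b"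
  obtains d where "d > 0" "\<And>s y. s \<in> I \<Longrightarrow> dist s t < d \<Longrightarrow> dist y x < d \<Longrightarrow> F s y < b"
proof -
  have "\<exists>d>0. \<forall>s y. s \<in> I \<longrightarrow> dist s t < d \<longrightarrow> dist y x < d \<longrightarrow> F s y < b"
  proof (rule ccontr)
    assume neg: "\<not> ?thesis"
    have "\<forall>n. \<exists>s y. s \<in> I \<and> dist s t < inverse (real (Suc n)) \<and>
        dist y x < inverse (real (Suc n)) \<and> b \<le> F s y"
    proof
      fix n
      have "0 < inverse (real (Suc n))" by simp
      with neg show "\<exists>s y. s \<in> I \<and> dist s t < inverse (real (Suc n)) \<and>
        dist y x < inverse (real (Suc n)) \<and> b \<le> F s y" by (meson not_le)
    qed
    then obtain s y where sy: "\<And>n. s n \<in> I" "\<And>n. dist (s n) t < inverse (real (Suc n))"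
      "\<And>n. dist (y n) x < inverse (real (Suc n))" "\<And>n. b \<le> F (s n) (y n)"
      by metis
    have "s \<longlonglongrightarrow> t" unfolding tendsto_dist_iff[of s]
      by (rule tendsto_sandwich[OF _ _ tendsto_const LIMSEQ_inverse_real_of_nat])
         (intro always_eventually allI less_imp_le sy(2) zero_le_dist)+
    moreover have "y \<longlonglongrightarrow> x" unfolding tendsto_dist_iff[of y]
      by (rule tendsto_sandwich[OF _ _ tendsto_const LIMSEQ_inverse_real_of_nat])
         (intro always_eventually allI less_imp_le sy(3) zero_le_dist)+
    ultimately have "limsup (\<lambda>n. F (s n) (y n)) \<le> Gamma_Limsup I t F x"
      using sy(1) by (intro Gamma_Limsup_ge) auto
    moreover have "b \<le> limsup (\<lambda>n. F (s n) (y n))"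
      using sy(4) by (intro le_Limsup always_eventually allI) auto
    ultimately show False using assms by simp
  qed
  then show ?thesis using that by blast
qed

lemma wnorm_le_iff:
  assumes "\<And>x. 0 < \<kappa> x"
  shows "wnorm \<kappa> f \<le> ereal c \<longleftrightarrow> (\<forall>x. \<bar>f x\<bar> \<le> c / \<kappa> x)"
  by (simp add: wnorm_def SUP_le_iff pos_le_divide_eq assms)

lemma wnorm_finiteE:
  assumes "\<And>x. 0 < \<kappa> x" "wnorm \<kappa> f < \<infinity>"
  obtains c where "c \<ge> 0" "\<And>x. \<bar>f x\<bar> \<le> c / \<kappa> x"
proof -
  obtain n :: nat where "wnorm \<kappa> f < ereal (real n)"
    using assms(2) less_PInf_Ex_of_nat by auto
  then have "wnorm \<kappa> f \<le> ereal (real n)" by simp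
  then show ?thesis using that[of "real n"] wnorm_le_iff[of \<kappa> f "real n"] assms(1) by simp
qed

lemma Limsup_wnorm_finiteE:
  assumes "\<And>x. 0 < \<kappa> x" "Limsup (at_right (0::real)) (\<lambda>h. wnorm \<kappa> (F h)) < \<infinity>"
  obtains c d where "c \<ge> 0" "d > 0" "\<And>h x. 0 < h \<Longrightarrow> h < d \<Longrightarrow> \<bar>F h x\<bar> \<le> c / \<kappa> x"
proof -
  obtain n :: nat where "Limsup (at_right 0) (\<lambda>h. wnorm \<kappa> (F h)) < ereal (real n)"
    using assms(2) less_PInf_Ex_of_nat by auto
  then have "\<forall>\<^sub>F h in at_right 0. wnorm \<kappa> (F h) < ereal (real n)" by (rule Limsup_lessD)
  then obtain d where "d > 0" "\<And>h. 0 < h \<Longrightarrow> h < d \<Longrightarrow> wnorm \<kappa> (F h) < ereal (real n)"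
    unfolding eventually_at_right_field by auto
  then have "\<bar>F h x\<bar> \<le> real n / \<kappa> x" if "0 < h" "h < d" for h x
    using that wnorm_le_iff[of \<kappa> "F h" "real n"] assms(1) by (simp add: less_imp_le)
  then show ?thesis using that[of "real n" d] \<open>d > 0\<close> by simp
qed

lemma C_spaceI:
  assumes "\<And>x. 0 < \<kappa> x" "continuous_on UNIV f" "\<And>x. \<bar>f x\<bar> \<le> c / \<kappa> x"
  shows "f \<in> C_space \<kappa>"
proof -
  have "wnorm \<kappa> f \<le> ereal c" using assms by (simp add: wnorm_le_iff)
  then have "wnorm \<kappa> f < \<infinity>" by (rule le_less_trans) simp
  with assms(2) show ?thesis by (simp add: C_space_def)
qed

lemma C_spaceE:
  assumes "\<And>x. 0 < \<kappa> x" "f \<in> C_space \<kappa>"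
  obtains c where "c \<ge> 0" "\<And>x. \<bar>f x\<bar> \<le> c / \<kappa> x"
  using assms wnorm_finiteE[of \<kappa> f] by (auto simp: C_space_def)

lemma C_space_lincomb:
  assumes pos: "\<And>x. 0 < \<kappa> x" and "f \<in> C_space \<kappa>" "g \<in> C_space \<kappa>"
  shows "(\<lambda>x. a * f x + b * g x) \<in> C_space \<kappa>"
proof -
  obtain c where c: "c \<ge> 0" "\<And>x. \<bar>f x\<bar> \<le> c / \<kappa> x" using C_spaceE[OF pos assms(2)] by blast
  obtain d where d: "d \<ge> 0" "\<And>x. \<bar>g x\<bar> \<le> d / \<kappa> x" using C_spaceE[OF pos assms(3)] by blast
  have "\<bar>a * f x + b * g x\<bar> \<le> (\<bar>a\<bar> * c + \<bar>b\<bar> * d) / \<kappa> x" for x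
  proof -
    have "\<bar>a * f x + b * g x\<bar> \<le> \<bar>a\<bar> * \<bar>f x\<bar> + \<bar>b\<bar> * \<bar>g x\<bar>"
      by (metis abs_mult abs_triangle_ineq)
    also have "\<dots> \<le> \<bar>a\<bar> * (c / \<kappa> x) + \<bar>b\<bar> * (d / \<kappa> x)"
      by (intro add_mono mult_left_mono c d) auto
    finally show ?thesis by (simp add: add_divide_distrib)
  qed
  moreover have "continuous_on UNIV (\<lambda>x. a * f x + b * g x)"
    using assms by (intro continuous_intros) (auto simp: C_space_def)
  ultimately show ?thesis using pos by (intro C_spaceI)
qed

text \<open>
  A family with nonpositive \<open>\<Gamma>\<close>-limit is dominated by continuous functions decreasing to \<open>0\<close>, to
  which the continuity from above of the semigroup applies. The envelope is the sup-convolution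
  of the weighted family with the kernel \<open>n * dist\<close>: it is \<open>n\<close>-Lipschitz, and as \<open>n\<close>
  grows, the penalty excludes all points but those near \<open>x\<close>, where the family is small.
\<close>

lemma continuous_envelope:
  fixes F :: "real \<Rightarrow> 'a::metric_space \<Rightarrow> real"
  assumes \<kappa>: "continuous_on UNIV \<kappa>" and pos: "\<And>x. 0 < \<kappa> x"
    and near: "\<And>x e. e > 0 \<Longrightarrow> \<exists>d>0. \<forall>s y. s \<in> I \<longrightarrow> dist s t < d \<longrightarrow> dist y x < d \<longrightarrow> F s y < e"
    and d0: "d0 > 0" and bound: "\<And>s y. s \<in> I \<Longrightarrow> dist s t < d0 \<Longrightarrow> F s y \<le> c / \<kappa> y"
  obtains E where "\<And>n::nat. E n \<in> C_space \<kappa>" "decseq E" "\<And>x. (\<lambda>n. E n x) \<longlonglongrightarrow> 0"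
    "\<And>n. \<exists>d>0. \<forall>s y. s \<in> I \<longrightarrow> dist s t < d \<longrightarrow> F s y \<le> E n y"
proof -
  define d where "d n = d0 / real (Suc n)" for n
  have dpos: "d n > 0" and d_le: "d n \<le> d0" for n
    using d0 by (simp_all add: d_def field_simps)
  \<comment> \<open>The inserted \<open>0\<close> takes the positive part and keeps the supremum meaningful when no parameter
      in \<open>I\<close> is close to \<open>t\<close>.\<close>
  define B where "B n x = insert 0 {F s y * \<kappa> y - real n * dist x y | s y. s \<in> I \<and> dist s t < d n}" for n x
  define e where "e n x = Sup (B n x)" for n x
  define C where "C = max c 0"
  have F_le: "F s y * \<kappa> y \<le> C" if "s \<in> I" "dist s t < d n" for s y n
    using bound[of s y] that d_le[of n] pos[of y] by (simp add: C_def pos_le_divide_eq)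
  have B_le: "z \<le> C" if zB: "z \<in> B n x" for z n x
  proof (cases "z = 0")
    case False
    with zB obtain s y where sy: "s \<in> I" "dist s t < d n" "z = F s y * \<kappa> y - real n * dist x y"
      by (auto simp: B_def)
    have "0 \<le> real n * dist x y" by simp
    with sy(3) F_le[OF sy(1,2)] show ?thesis by (metis diff_ge_0_iff_ge diff_le_eq le_add_same_cancel1 order_trans)
  qed (simp add: C_def)
  have bdd: "bdd_above (B n x)" for n x using B_le by (rule bdd_aboveI)
  have ne: "B n x \<noteq> {}" for n x by (simp add: B_def)
  have e0: "0 \<le> e n x" for n x unfolding e_def by (rule cSup_upper[OF _ bdd]) (simp add: B_def)
  have eC: "e n x \<le> C" for n x unfolding e_def by (rule cSup_least[OF ne B_le])
  have e_ge: "F s y * \<kappa> y - real n * dist x y \<le> e n x" if "s \<in> I" "dist s t < d n" for s y n x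
    unfolding e_def by (rule cSup_upper[OF _ bdd]) (use that in \<open>auto simp: B_def\<close>)
  have e_leI: "e n x \<le> z"
    if "0 \<le> z" "\<And>s y. s \<in> I \<Longrightarrow> dist s t < d n \<Longrightarrow> F s y * \<kappa> y - real n * dist x y \<le> z" for n x z
    unfolding e_def by (rule cSup_least[OF ne]) (use that in \<open>auto simp: B_def\<close>)
  have lip1: "e n x \<le> e n x' + real n * dist x x'" for n x x'
  proof (rule e_leI)
    fix s y assume "s \<in> I" "dist s t < d n"
    moreover have "real n * dist x' y \<le> real n * dist x x' + real n * dist x y"
      by (metis dist_commute dist_triangle distrib_left mult_left_mono of_nat_0_le_iff)
    ultimately show "F s y * \<kappa> y - real n * dist x y \<le> e n x' + real n * dist x x'"
      using e_ge[of s n y x'] by linarith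
  qed (use e0[of n x'] in simp)
  have "(real n)-lipschitz_on UNIV (e n)" for n
  proof (rule lipschitz_onI)
    fix x y show "dist (e n x) (e n y) \<le> real n * dist x y"
      using lip1[of n x y] lip1[of n y x] by (simp add: dist_real_def dist_commute abs_le_iff)
  qed simp
  then have e_cont: "continuous_on UNIV (e n)" for n by (rule lipschitz_on_continuous_on)
  have e_decr: "e (Suc n) x \<le> e n x" for n x
  proof (rule e_leI[OF e0])
    fix s y assume s: "s \<in> I" "dist s t < d (Suc n)"
    have "d (Suc n) \<le> d n" using d0 by (simp add: d_def frac_le)
    with s e_ge[of s n y x] have "F s y * \<kappa> y - real n * dist x y \<le> e n x" by simp
    moreover have "real n * dist x y \<le> real (Suc n) * dist x y" by (intro mult_right_mono) auto
    ultimately show "F s y * \<kappa> y - real (Suc n) * dist x y \<le> e n x" by linarith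
  qed
  have e_lim: "(\<lambda>n. e n x) \<longlonglongrightarrow> 0" for x
  proof (rule LIMSEQ_I)
    fix r :: real assume r: "r > 0"
    have "continuous (at x) \<kappa>" using \<kappa> by (simp add: continuous_on_eq_continuous_at)
    then obtain d1 where d1: "d1 > 0" "\<And>y. dist y x < d1 \<Longrightarrow> dist (\<kappa> y) (\<kappa> x) < 1"
      unfolding continuous_at_eps_delta by (metis zero_less_one)
    have K: "0 < \<kappa> x + 1" using pos[of x] by simp
    then have "0 < r / 2 / (\<kappa> x + 1)" using r by simp
    from near[OF this, of x] obtain d2 where d2: "d2 > 0"
      "\<And>s y. s \<in> I \<Longrightarrow> dist s t < d2 \<Longrightarrow> dist y x < d2 \<Longrightarrow> F s y < r / 2 / (\<kappa> x + 1)" by blast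
    define d3 where "d3 = min d1 d2"
    have d3: "d3 > 0" using d1 d2 by (simp add: d3_def)
    obtain N :: nat where N: "max (d0 / d2) (C / d3) < real N" using reals_Archimedean2 by blast
    show "\<exists>N. \<forall>n\<ge>N. norm (e n x - 0) < r"
    proof (intro exI allI impI)
      fix n assume "n \<ge> N"
      then have n: "d0 / d2 < real n" "C / d3 < real n" using N by auto
      have dn: "d n < d2" using n(1) d2(1) d0 by (simp add: d_def field_simps)
      have Cn: "C < real n * d3" using n(2) d3 by (simp add: pos_divide_less_eq)
      have "e n x \<le> r / 2"
      proof (rule e_leI)
        fix s y assume s: "s \<in> I" "dist s t < d n"
        show "F s y * \<kappa> y - real n * dist x y \<le> r / 2"
        proof (cases "dist y x < d3")
          case True
          then have F: "F s y < r / 2 / (\<kappa> x + 1)" using d2(2)[of s y] s dn by (simp add: d3_def)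
          have "\<kappa> y < \<kappa> x + 1" using d1(2)[of y] True by (auto simp: d3_def dist_real_def)
          then have "F s y * \<kappa> y \<le> r / 2 / (\<kappa> x + 1) * (\<kappa> x + 1)"
            using F pos[of y] r K by (intro mult_mono) auto
          also have "\<dots> = r / 2" using K by (simp add: field_simps)
          finally have "F s y * \<kappa> y \<le> r / 2" .
          moreover have "0 \<le> real n * dist x y" by simp
          ultimately show ?thesis by linarith
        next
          case False
          then have "real n * d3 \<le> real n * dist x y" by (intro mult_left_mono) (auto simp: dist_commute)
          with F_le[OF s, of y] Cn r show ?thesis by linarith
        qed
      qed (use r in simp)
      with e0[of n x] r show "norm (e n x - 0) < r" by simp
    qed
  qed
  define E where "E n x = e n x / \<kappa> x" for n x
  show ?thesis
  proof (rule that[of E])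
    show "E n \<in> C_space \<kappa>" for n
    proof (rule C_spaceI[OF pos])
      show "continuous_on UNIV (E n)"
        unfolding E_def using pos by (intro continuous_intros e_cont \<kappa>) (auto simp: less_imp_neq[THEN not_sym])
      show "\<bar>E n x\<bar> \<le> C / \<kappa> x" for x
        using e0[of n x] eC[of n x] pos[of x] by (simp add: E_def divide_right_mono less_imp_le)
    qed
    show "decseq E"
      using e_decr pos by (intro decseq_SucI le_funI) (simp add: E_def divide_right_mono less_imp_le)
    show "(\<lambda>n. E n x) \<longlonglongrightarrow> 0" for x
      unfolding E_def using tendsto_divide[OF e_lim[of x] tendsto_const[of "\<kappa> x"]] pos[of x] by simp
    show "\<exists>d>0. \<forall>s y. s \<in> I \<longrightarrow> dist s t < d \<longrightarrow> F s y \<le> E n y" for n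
    proof (intro exI conjI allI impI)
      fix s y assume "s \<in> I" "dist s t < d n"
      from e_ge[OF this, of y y] show "F s y \<le> E n y"
        using pos[of y] by (simp add: E_def pos_le_divide_eq)
    qed (rule dpos)
  qed
qed


section \<open>Convex monotone semigroups\<close>

locale convex_semigroup =
  fixes \<kappa> :: "'a::metric_space \<Rightarrow> real" and S :: "real \<Rightarrow> ('a \<Rightarrow> real) \<Rightarrow> 'a \<Rightarrow> real"
  assumes \<kappa>_cont: "continuous_on UNIV \<kappa>" and \<kappa>_pos: "\<And>x. 0 < \<kappa> x"
    and semigroup: "convex_monotone_semigroup \<kappa> S"
begin

abbreviation "C \<equiv> C_space \<kappa>"

lemmas C_lincomb = C_space_lincomb[of \<kappa>, OF \<kappa>_pos]

lemma C_scale: "f \<in> C \<Longrightarrow> (\<lambda>x. a * f x) \<in> C"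
  using C_lincomb[of f f a 0] by simp

lemma C_add: "f \<in> C \<Longrightarrow> g \<in> C \<Longrightarrow> (\<lambda>x. f x + g x) \<in> C"
  using C_lincomb[of f g 1 1] by simp

lemma C_diff: "f \<in> C \<Longrightarrow> g \<in> C \<Longrightarrow> (\<lambda>x. f x - g x) \<in> C"
  using C_lincomb[of f g 1 "-1"] by simp

lemma C_weight: "(\<lambda>x. r / \<kappa> x) \<in> C"
proof (rule C_spaceI[OF \<kappa>_pos])
  show "continuous_on UNIV (\<lambda>x. r / \<kappa> x)"
    using \<kappa>_pos by (intro continuous_intros \<kappa>_cont) (auto simp: less_imp_neq[THEN not_sym])
  show "\<bar>r / \<kappa> x\<bar> \<le> \<bar>r\<bar> / \<kappa> x" for x using \<kappa>_pos[of x] by simp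
qed

lemma C_zero: "(\<lambda>x. 0) \<in> C"
  using C_weight[of 0] by simp

lemma C_continuousD:
  assumes "f \<in> C" "e > 0"
  obtains d where "d > 0" "\<And>y. dist y x < d \<Longrightarrow> \<bar>f y - f x\<bar> < e"
proof -
  have "continuous (at x) f"
    using assms by (simp add: C_space_def continuous_on_eq_continuous_at)
  then show ?thesis
    using that assms(2) unfolding continuous_at_eps_delta by (auto simp: dist_real_def)
qed

lemma S_C: "0 \<le> t \<Longrightarrow> f \<in> C \<Longrightarrow> S t f \<in> C"
  using semigroup by (simp add: convex_monotone_semigroup_def)

lemma S_convex:
  assumes "0 \<le> t" "f \<in> C" "g \<in> C" "0 \<le> l" "l \<le> 1"
  shows "S t (\<lambda>x. l * f x + (1 - l) * g x) x \<le> l * S t f x + (1 - l) * S t g x"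
proof -
  have "S t (\<lambda>x. l * f x + (1 - l) * g x) \<le> (\<lambda>x. l * S t f x + (1 - l) * S t g x)"
    using semigroup assms by (simp add: convex_monotone_semigroup_def)
  then show ?thesis by (rule le_funD)
qed

lemma S_mono:
  assumes "0 \<le> t" "f \<in> C" "g \<in> C" "\<And>y. f y \<le> g y"
  shows "S t f x \<le> S t g x"
proof -
  have "f \<le> g" using assms(4) by (rule le_funI)
  then have "S t f \<le> S t g"
    using semigroup assms by (simp add: convex_monotone_semigroup_def)
  then show ?thesis by (rule le_funD)
qed

lemma S_decreasing_to_0:
  assumes "0 \<le> t" "\<And>n::nat. E n \<in> C" "decseq E" "\<And>x. (\<lambda>n. E n x) \<longlonglongrightarrow> 0"
  shows "(\<lambda>n. S t (E n) x) \<longlonglongrightarrow> 0"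
  using semigroup assms by (simp add: convex_monotone_semigroup_def)

lemma S_0: "f \<in> C \<Longrightarrow> S 0 f = f"
  using semigroup by (simp add: convex_monotone_semigroup_def)

lemma S_add: "0 \<le> s \<Longrightarrow> 0 \<le> t \<Longrightarrow> f \<in> C \<Longrightarrow> S (s + t) f = S s (S t f)"
  using semigroup by (simp add: convex_monotone_semigroup_def)

lemma S_zero: "0 \<le> t \<Longrightarrow> S t (\<lambda>x. 0) x = 0"
  using S_decreasing_to_0[of t "\<lambda>_ _. 0" x] C_zero
  by (simp add: decseq_def LIMSEQ_const_iff)

lemma S_weight_bound:
  assumes "0 \<le> r" "0 \<le> T"
  obtains c where "c \<ge> 0" "\<And>t x. 0 \<le> t \<Longrightarrow> t \<le> T \<Longrightarrow> \<bar>S t (\<lambda>x. r / \<kappa> x) x\<bar> \<le> c / \<kappa> x"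
proof -
  have "(SUP t\<in>{0..T}. wnorm \<kappa> (S t (\<lambda>x. r / \<kappa> x))) < \<infinity>"
    using semigroup assms by (simp add: convex_monotone_semigroup_def)
  then obtain n :: nat where "(SUP t\<in>{0..T}. wnorm \<kappa> (S t (\<lambda>x. r / \<kappa> x))) < ereal (real n)"
    using less_PInf_Ex_of_nat by auto
  then have "wnorm \<kappa> (S t (\<lambda>x. r / \<kappa> x)) \<le> ereal (real n)" if "0 \<le> t" "t \<le> T" for t
    using that by (intro order_trans[OF SUP_upper less_imp_le]) auto
  then show ?thesis using that[of "real n"] wnorm_le_iff[of \<kappa> _ "real n"] \<kappa>_pos by simp
qed

text \<open>
  Monotonicity bounds \<open>S t f\<close> from above. The bound from below comes from convexity, as
  \<open>0 = S t 0\<close> lies below the mean of \<open>S t f\<close> and \<open>S t (- f)\<close>.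
\<close>

lemma S_bound:
  assumes "0 \<le> r" "0 \<le> T"
  obtains c where "c \<ge> 0"
    "\<And>t f x. 0 \<le> t \<Longrightarrow> t \<le> T \<Longrightarrow> f \<in> C \<Longrightarrow> (\<And>y. \<bar>f y\<bar> \<le> r / \<kappa> y) \<Longrightarrow> \<bar>S t f x\<bar> \<le> c / \<kappa> x"
proof -
  obtain c where c: "c \<ge> 0" "\<And>t x. 0 \<le> t \<Longrightarrow> t \<le> T \<Longrightarrow> \<bar>S t (\<lambda>x. r / \<kappa> x) x\<bar> \<le> c / \<kappa> x"
    using S_weight_bound[OF assms] by blast
  show ?thesis
  proof (rule that[OF c(1)])
    fix t f x assume t: "0 \<le> t" "t \<le> T" and f: "f \<in> C" "\<And>y. \<bar>f y\<bar> \<le> r / \<kappa> y"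
    have upper: "S t g x \<le> c / \<kappa> x" if "g \<in> C" "\<And>y. \<bar>g y\<bar> \<le> r / \<kappa> y" for g
    proof -
      have "S t g x \<le> S t (\<lambda>x. r / \<kappa> x) x"
        using that t by (intro S_mono C_weight) (auto dest: abs_le_D1)
      with c(2)[OF t, of x] show ?thesis by linarith
    qed
    have nf: "(\<lambda>y. - f y) \<in> C" using C_scale[OF f(1), of "-1"] by simp
    have "0 \<le> 1/2 * S t f x + (1 - 1/2) * S t (\<lambda>y. - f y) x"
      using S_convex[OF t(1) f(1) nf, of "1/2" x] S_zero[OF t(1), of x] by simp
    with upper[OF f] upper[OF nf] f(2) show "\<bar>S t f x\<bar> \<le> c / \<kappa> x" by simp
  qed
qed

lemma S_time_usc:
  assumes "0 \<le> t" "f \<in> C" "e > 0"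
  obtains d where "d > 0" "\<And>s. 0 \<le> s \<Longrightarrow> dist s t < d \<Longrightarrow> S s f x < S t f x + e"
proof -
  have "Gamma_Limsup {0..} t (\<lambda>s x. ereal (S s f x)) \<le> (\<lambda>x. ereal (S t f x))"
    using semigroup assms by (simp add: convex_monotone_semigroup_def)
  then have "Gamma_Limsup {0..} t (\<lambda>s x. ereal (S s f x)) x \<le> ereal (S t f x)" by (rule le_funD)
  also have "\<dots> < ereal (S t f x + e)" using assms by simp
  finally obtain d where "d > 0" "\<And>s y. s \<in> {0..} \<Longrightarrow> dist s t < d \<Longrightarrow> dist y x < d \<Longrightarrow>
      ereal (S s f y) < ereal (S t f x + e)" by (rule Gamma_Limsup_lessD) blast
  then show ?thesis using that[of d] by simp
qed

lemma S_secant: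
  assumes "0 \<le> t" "f \<in> C" "k \<in> C" "0 \<le> l" "l \<le> 1"
  shows "S t (\<lambda>y. f y + l * k y) x - S t f x \<le> l * (S t (\<lambda>y. f y + k y) x - S t f x)"
proof -
  have "(\<lambda>y. f y + l * k y) = (\<lambda>y. l * (f y + k y) + (1 - l) * f y)"
    by (simp add: algebra_simps)
  then show ?thesis
    using S_convex[OF assms(1) C_add[OF assms(2,3)] assms(2,4,5), of x]
    by (simp add: algebra_simps)
qed

text \<open>
  The bound is uniform in \<open>f\<close> over bounded sets. By convexity, adding \<open>h * E\<close> costs at most
  \<open>h * l\<close> times the cost of adding \<open>E / l\<close>. For small \<open>l\<close>, the part of this cost that involves \<open>f\<close> is
  small because \<open>f\<close> is bounded; once \<open>l\<close> is fixed, continuity from above makes the rest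
  small for large \<open>N\<close>.
\<close>

lemma S_perturbation:
  assumes E: "\<And>n::nat. E n \<in> C" "decseq E" "\<And>x. (\<lambda>n. E n x) \<longlonglongrightarrow> 0"
    and r: "0 \<le> r" and t: "0 \<le> t" and \<eta>: "\<eta> > 0"
  obtains N d where "d > 0"
    "\<And>s f h. 0 \<le> s \<Longrightarrow> dist s t < d \<Longrightarrow> f \<in> C \<Longrightarrow> (\<And>y. \<bar>f y\<bar> \<le> r / \<kappa> y) \<Longrightarrow> 0 \<le> h \<Longrightarrow> h \<le> 1 \<Longrightarrow>
      S s (\<lambda>y. f y + h * E N y) x \<le> S s f x + h * \<eta>"
proof -
  obtain c where c: "c \<ge> 0"
    "\<And>s f x. 0 \<le> s \<Longrightarrow> s \<le> t + 1 \<Longrightarrow> f \<in> C \<Longrightarrow> (\<And>y. \<bar>f y\<bar> \<le> 2 * r / \<kappa> y) \<Longrightarrow> \<bar>S s f x\<bar> \<le> c / \<kappa> x"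
    using S_bound[of "2 * r" "t + 1"] r t by auto
  \<comment> \<open>\<open>K\<close> bounds \<open>S s (2 * f) x / 2 - S s f x\<close>, and \<open>l\<close> is chosen to make \<open>l * K\<close> at most \<open>\<eta> / 2\<close>.\<close>
  define K where "K = 2 * c / \<kappa> x"
  have K: "K \<ge> 0" using c(1) \<kappa>_pos[of x] by (simp add: K_def)
  define l where "l = min 1 (\<eta> / 2 / (K + 1))"
  have l: "0 < l" "l \<le> 1" using \<eta> K by (auto simp: l_def)
  have "l * K \<le> \<eta> / 2 / (K + 1) * (K + 1)"
    using K \<eta> by (intro mult_mono) (auto simp: l_def)
  also have "\<dots> = \<eta> / 2" using K by (simp add: field_simps)
  finally have lK: "l * K \<le> \<eta> / 2" .
  define G where "G n = (\<lambda>y. 2 / l * E n y)" for n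
  have G: "G n \<in> C" for n unfolding G_def by (intro C_scale E)
  have "decseq G"
  proof (intro decseq_SucI le_funI)
    fix n y
    have "E (Suc n) y \<le> E n y" using decseq_SucD[OF E(2)] by (rule le_funD)
    then show "G (Suc n) y \<le> G n y" using l by (simp add: G_def divide_right_mono)
  qed
  moreover have "(\<lambda>n. G n y) \<longlonglongrightarrow> 0" for y
    unfolding G_def using tendsto_mult_right_zero[OF E(3)] by blast
  ultimately have "(\<lambda>n. S t (G n) x) \<longlonglongrightarrow> 0" using G by (intro S_decreasing_to_0 t)
  from LIMSEQ_D[OF this, of "\<eta> / 2"] \<eta> obtain N where "\<bar>S t (G N) x\<bar> < \<eta> / 2" by auto
  then have N: "S t (G N) x < \<eta> / 2" by simp
  obtain d where d: "d > 0" "\<And>s. 0 \<le> s \<Longrightarrow> dist s t < d \<Longrightarrow> S s (G N) x < S t (G N) x + \<eta> / 2"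
    using S_time_usc[OF t G, of "\<eta> / 2" N x] \<eta> by auto
  show ?thesis
  proof (rule that[of "min d 1" N])
    show "min d 1 > 0" using d by simp
    fix s f h assume s: "0 \<le> s" "dist s t < min d 1" and f: "f \<in> C" "\<And>y. \<bar>f y\<bar> \<le> r / \<kappa> y"
      and h: "0 \<le> (h::real)" "h \<le> 1"
    have st: "s \<le> t + 1" using s(2) by (auto simp: dist_real_def abs_less_iff)
    define k where "k = (\<lambda>y. E N y / l)"
    have kC: "k \<in> C" unfolding k_def using C_scale[OF E(1)[of N], of "1/l"] by simp
    have f2: "(\<lambda>y. 2 * f y) \<in> C" by (rule C_scale[OF f(1)])
    have hl: "0 \<le> h * l" "h * l \<le> 1" using h l by (auto intro: mult_le_one)
    have "S s (\<lambda>y. f y + h * E N y) x = S s (\<lambda>y. f y + (h * l) * k y) x"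
      using l by (simp add: k_def)
    also have "\<dots> \<le> S s f x + h * l * (S s (\<lambda>y. f y + k y) x - S s f x)"
      using S_secant[OF s(1) f(1) kC hl, of x] by simp
    also have "S s (\<lambda>y. f y + k y) x \<le> 1/2 * S s (\<lambda>y. 2 * f y) x + (1 - 1/2) * S s (G N) x"
      using S_convex[OF s(1) f2 G, of "1/2" N x] by (simp add: k_def G_def)
    also have "h * l * (1/2 * S s (\<lambda>y. 2 * f y) x + (1 - 1/2) * S s (G N) x - S s f x) \<le> h * \<eta>"
    proof -
      have rr: "r / \<kappa> y \<le> 2 * r / \<kappa> y" for y using r \<kappa>_pos[of y] by (intro divide_right_mono) (auto simp: less_imp_le)
      have "\<bar>S s f x\<bar> \<le> c / \<kappa> x" using f(2) rr by (intro c(2) s st f(1)) (rule order_trans)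
      moreover have "\<bar>S s (\<lambda>y. 2 * f y) x\<bar> \<le> c / \<kappa> x"
      proof (intro c(2) s st f2)
        fix y show "\<bar>2 * f y\<bar> \<le> 2 * r / \<kappa> y" using f(2)[of y] by (simp add: abs_mult)
      qed
      moreover have "S s (G N) x \<le> \<eta>" using d(2)[of s] s N by simp
      ultimately have "1/2 * S s (\<lambda>y. 2 * f y) x + (1 - 1/2) * S s (G N) x - S s f x \<le> K + \<eta> / 2"
        unfolding K_def by simp
      then have "l * (1/2 * S s (\<lambda>y. 2 * f y) x + (1 - 1/2) * S s (G N) x - S s f x) \<le> l * (K + \<eta> / 2)"
        using l by (intro mult_left_mono) auto
      also have "\<dots> \<le> \<eta>"
      proof -
        have "l * (\<eta> / 2) \<le> 1 * (\<eta> / 2)" using l \<eta> by (intro mult_right_mono) auto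
        with lK show ?thesis by (simp add: distrib_left)
      qed
      finally show ?thesis using h by (simp add: mult.assoc mult_left_mono)
    qed
    finally show "S s (\<lambda>y. f y + h * E N y) x \<le> S s f x + h * \<eta>" using hl by (simp add: mult_left_mono)
  qed
qed

text \<open>
  If the \<open>\<Gamma>\<close>-limit superior of \<open>\<phi> s\<close> is at most \<open>f\<close> as \<open>s \<rightarrow> t\<close>, then the limit superior of
  \<open>S (\<theta> s) (\<phi> s) x\<close> is at most \<open>S \<theta>0 f x\<close>: an envelope of \<open>\<phi> s - f\<close> is a small perturbation of
  \<open>f\<close>. The requirement on \<open>\<theta>\<close> covers the only time changes that occur, \<open>\<theta> s = \<theta>0 - (s - t)\<close>.
\<close>

lemma S_Gamma_usc:
  fixes \<phi> :: "real \<Rightarrow> 'a \<Rightarrow> real"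
  assumes f: "f \<in> C" and \<phi>: "\<And>s. s \<in> I \<Longrightarrow> \<phi> s \<in> C"
    and near: "\<And>y e. e > 0 \<Longrightarrow>
      \<exists>d>0. \<forall>s z. s \<in> I \<longrightarrow> dist s t < d \<longrightarrow> dist z y < d \<longrightarrow> \<phi> s z < f y + e"
    and d0: "d0 > 0" and bound: "\<And>s y. s \<in> I \<Longrightarrow> dist s t < d0 \<Longrightarrow> \<phi> s y \<le> c / \<kappa> y"
    and \<theta>0: "0 \<le> \<theta>0" and \<theta>: "\<And>s. s \<in> I \<Longrightarrow> 0 \<le> \<theta> s \<and> dist (\<theta> s) \<theta>0 \<le> dist s t"
    and \<eta>: "\<eta> > 0"
  shows "\<exists>d>0. \<forall>s\<in>I. dist s t < d \<longrightarrow> S (\<theta> s) (\<phi> s) x < S \<theta>0 f x + \<eta>"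
proof -
  obtain r where r: "r \<ge> 0" "\<And>y. \<bar>f y\<bar> \<le> r / \<kappa> y" using C_spaceE[OF \<kappa>_pos f] by blast
  have n: "\<exists>d>0. \<forall>s z. s \<in> I \<longrightarrow> dist s t < d \<longrightarrow> dist z y < d \<longrightarrow> \<phi> s z - f z < e" if "e > 0" for y e
  proof -
    obtain d1 where d1: "d1 > 0"
        "\<And>s z. s \<in> I \<Longrightarrow> dist s t < d1 \<Longrightarrow> dist z y < d1 \<Longrightarrow> \<phi> s z < f y + e / 2"
      using near[of "e / 2" y] \<open>e > 0\<close> by auto
    obtain d2 where d2: "d2 > 0" "\<And>z. dist z y < d2 \<Longrightarrow> \<bar>f z - f y\<bar> < e / 2"
      using C_continuousD[OF f, of "e / 2" y] \<open>e > 0\<close> by auto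
    show ?thesis
    proof (intro exI[of _ "min d1 d2"] conjI allI impI)
      fix s z assume "s \<in> I" "dist s t < min d1 d2" "dist z y < min d1 d2"
      then have "\<phi> s z < f y + e / 2" "\<bar>f z - f y\<bar> < e / 2" using d1(2)[of s z] d2(2)[of z] by auto
      then show "\<phi> s z - f z < e" by linarith
    qed (use d1 d2 in simp)
  qed
  have b: "\<phi> s y - f y \<le> (c + r) / \<kappa> y" if "s \<in> I" "dist s t < d0" for s y
    using bound[OF that, of y] r(2)[of y] by (simp add: add_divide_distrib abs_le_iff)
  obtain E where E: "\<And>n::nat. E n \<in> C" "decseq E" "\<And>x. (\<lambda>n. E n x) \<longlonglongrightarrow> 0"
      "\<And>n. \<exists>d>0. \<forall>s y. s \<in> I \<longrightarrow> dist s t < d \<longrightarrow> \<phi> s y - f y \<le> E n y"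
    using continuous_envelope[where F = "\<lambda>s y. \<phi> s y - f y", OF \<kappa>_cont \<kappa>_pos n d0 b] by blast
  obtain N d1 where d1: "d1 > 0"
    "\<And>s g h. 0 \<le> s \<Longrightarrow> dist s \<theta>0 < d1 \<Longrightarrow> g \<in> C \<Longrightarrow> (\<And>y. \<bar>g y\<bar> \<le> r / \<kappa> y) \<Longrightarrow> 0 \<le> h \<Longrightarrow> h \<le> 1 \<Longrightarrow>
      S s (\<lambda>y. g y + h * E N y) x \<le> S s g x + h * (\<eta> / 2)"
    by (rule S_perturbation[where x = x, OF E(1-3) r(1) \<theta>0 half_gt_zero[OF \<eta>]]) blast
  obtain d2 where d2: "d2 > 0" "\<And>s y. s \<in> I \<Longrightarrow> dist s t < d2 \<Longrightarrow> \<phi> s y - f y \<le> E N y"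
    using E(4)[of N] by blast
  obtain d3 where d3: "d3 > 0" "\<And>s. 0 \<le> s \<Longrightarrow> dist s \<theta>0 < d3 \<Longrightarrow> S s f x < S \<theta>0 f x + \<eta> / 2"
    using S_time_usc[OF \<theta>0 f, of "\<eta> / 2" x] \<eta> by auto
  show ?thesis
  proof (intro exI[of _ "min d1 (min d2 d3)"] conjI ballI impI)
    show "min d1 (min d2 d3) > 0" using d1 d2 d3 by simp
    fix s assume s: "s \<in> I" "dist s t < min d1 (min d2 d3)"
    have \<theta>s: "0 \<le> \<theta> s" "dist (\<theta> s) \<theta>0 < d1" "dist (\<theta> s) \<theta>0 < d3" using \<theta>[OF s(1)] s(2) by auto
    have "S (\<theta> s) (\<phi> s) x \<le> S (\<theta> s) (\<lambda>y. f y + E N y) x"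
      using d2(2)[OF s(1)] s(2) by (intro S_mono \<theta>s \<phi> s C_add f E(1)) (simp add: diff_le_eq add.commute)
    also have "\<dots> \<le> S (\<theta> s) f x + \<eta> / 2"
      using d1(2)[OF \<theta>s(1,2) f r(2), of 1] by simp
    also have "\<dots> < S \<theta>0 f x + \<eta>" using d3(2)[OF \<theta>s(1,3)] by simp
    finally show "S (\<theta> s) (\<phi> s) x < S \<theta>0 f x + \<eta>" .
  qed
qed

section \<open>Orbits of upper Lipschitz functions\<close>

lemma upper_Lipschitz_setE:
  assumes "g \<in> upper_Lipschitz_set \<kappa> S"
  obtains c d where "c \<ge> 0" "d > 0"
    "\<And>h x. 0 < h \<Longrightarrow> h < d \<Longrightarrow> S h g x \<le> g x + h * (c / \<kappa> x)"
proof -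
  have "Limsup (at_right 0) (\<lambda>h. wnorm \<kappa> (\<lambda>x. pos_part (\<lambda>y. S h g y - g y) x / h)) < \<infinity>"
    using assms by (simp add: upper_Lipschitz_set_def)
  then obtain c d where cd: "c \<ge> 0" "d > 0"
    "\<And>h x. 0 < h \<Longrightarrow> h < d \<Longrightarrow> \<bar>pos_part (\<lambda>y. S h g y - g y) x / h\<bar> \<le> c / \<kappa> x"
    by (rule Limsup_wnorm_finiteE[where \<kappa> = \<kappa>, OF \<kappa>_pos]) blast
  show ?thesis
  proof (rule that[OF cd(1,2)])
    fix h x assume h: "0 < (h::real)" "h < d"
    have "(S h g x - g x) / h \<le> pos_part (\<lambda>y. S h g y - g y) x / h"
      using h by (intro divide_right_mono) (auto simp: pos_part_def)
    also have "\<dots> \<le> c / \<kappa> x" using cd(3)[OF h, of x] by linarith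
    finally show "S h g x \<le> g x + h * (c / \<kappa> x)" using h by (simp add: pos_divide_le_eq mult.commute)
  qed
qed

lemma upper_Lipschitz_set_C: "g \<in> upper_Lipschitz_set \<kappa> S \<Longrightarrow> g \<in> C"
  by (simp add: upper_Lipschitz_set_def)

text \<open>
  The increase \<open>S \<epsilon> g - g \<le> \<epsilon> * c / \<kappa>\<close> is propagated by \<open>S \<sigma>\<close> at a cost linear in \<open>\<epsilon>\<close>, by convexity.
\<close>

lemma orbit_upper_Lipschitz:
  assumes g: "g \<in> upper_Lipschitz_set \<kappa> S" and \<tau>: "0 \<le> \<tau>"
  obtains K d where "K \<ge> 0" "d > 0"
    "\<And>\<sigma> \<epsilon>. 0 \<le> \<sigma> \<Longrightarrow> 0 \<le> \<epsilon> \<Longrightarrow> \<epsilon> < d \<Longrightarrow> \<sigma> + \<epsilon> \<le> \<tau> \<Longrightarrow> S (\<sigma> + \<epsilon>) g x \<le> S \<sigma> g x + K * \<epsilon>"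
proof -
  note gC = upper_Lipschitz_set_C[OF g]
  obtain c d where cd: "c \<ge> 0" "d > 0"
    "\<And>h x. 0 < h \<Longrightarrow> h < d \<Longrightarrow> S h g x \<le> g x + h * (c / \<kappa> x)"
    using upper_Lipschitz_setE[OF g] by blast
  obtain r where r: "r \<ge> 0" "\<And>y. \<bar>g y\<bar> \<le> r / \<kappa> y" using C_spaceE[OF \<kappa>_pos gC] by blast
  obtain b where b: "b \<ge> 0"
    "\<And>t f x. 0 \<le> t \<Longrightarrow> t \<le> \<tau> \<Longrightarrow> f \<in> C \<Longrightarrow> (\<And>y. \<bar>f y\<bar> \<le> (r + c) / \<kappa> y) \<Longrightarrow> \<bar>S t f x\<bar> \<le> b / \<kappa> x"
    using S_bound[of "r + c" \<tau>] r(1) cd(1) \<tau> by auto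
  have ck: "0 \<le> c / \<kappa> y" for y using cd(1) \<kappa>_pos[of y] by simp
  show ?thesis
  proof (rule that[of "2 * (b / \<kappa> x)" "min d 1"])
    show "2 * (b / \<kappa> x) \<ge> 0" using b(1) \<kappa>_pos[of x] by simp
    show "min d 1 > 0" using cd by simp
    fix \<sigma> \<epsilon> :: real assume a: "0 \<le> \<sigma>" "0 \<le> \<epsilon>" "\<epsilon> < min d 1" "\<sigma> + \<epsilon> \<le> \<tau>"
    show "S (\<sigma> + \<epsilon>) g x \<le> S \<sigma> g x + 2 * (b / \<kappa> x) * \<epsilon>"
    proof (cases "\<epsilon> = 0")
      case False
      with a have e: "0 < \<epsilon>" "\<epsilon> < d" "\<epsilon> \<le> 1" "\<sigma> \<le> \<tau>" by auto
      have "S (\<sigma> + \<epsilon>) g x = S \<sigma> (S \<epsilon> g) x" using a gC by (simp add: S_add)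
      also have "\<dots> \<le> S \<sigma> (\<lambda>y. g y + \<epsilon> * (c / \<kappa> y)) x"
        using a e cd(3) by (intro S_mono S_C C_add C_scale C_weight gC) auto
      also have "\<dots> \<le> S \<sigma> g x + \<epsilon> * (S \<sigma> (\<lambda>y. g y + c / \<kappa> y) x - S \<sigma> g x)"
        using S_secant[OF a(1) gC C_weight[of c], of \<epsilon> x] e by simp
      also have "\<dots> \<le> S \<sigma> g x + \<epsilon> * (2 * (b / \<kappa> x))"
      proof -
        have "\<bar>g y\<bar> \<le> (r + c) / \<kappa> y" "\<bar>g y + c / \<kappa> y\<bar> \<le> (r + c) / \<kappa> y" for y
          using r(2)[of y] ck[of y] by (simp_all add: add_divide_distrib abs_le_iff)
        then have "\<bar>S \<sigma> g x\<bar> \<le> b / \<kappa> x" "\<bar>S \<sigma> (\<lambda>y. g y + c / \<kappa> y) x\<bar> \<le> b / \<kappa> x"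
          using a e by (auto intro!: b(2) gC C_add C_weight)
        then show ?thesis using e by (intro add_left_mono mult_left_mono) linarith+
      qed
      finally show ?thesis by (simp add: mult_ac)
    qed simp
  qed
qed

text \<open>
  Since \<open>S \<epsilon> g\<close> is the convex combination with weight \<open>\<epsilon> / h\<close> of \<open>g\<close> and
  \<open>g + h * (S \<epsilon> g - g) / \<epsilon>\<close>, the increment of the orbit is bounded by a secant whose far
  end has \<open>\<Gamma>\<close>-limit superior at most \<open>g + h * A g\<close>, with \<open>A\<close> the upper generator. The step \<open>h\<close> stays
  fixed while \<open>\<epsilon> \<rightarrow> 0\<close>; so only a continuous majorant \<open>G\<close> of that limit enters, and the missing
  continuity of \<open>A g\<close> does no harm.
\<close>

lemma orbit_left_derivative:
  assumes g: "g \<in> upper_Lipschitz_set \<kappa> S" and G: "G \<in> C"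
    and gen: "\<And>y. upper_Gamma_generator S g y \<le> ereal ((G y - g y) / h)"
    and h: "h > 0" and \<rho>: "\<rho> > 0" and \<eta>: "\<eta> > 0"
  obtains d where "d > 0" "\<And>\<epsilon>. 0 < \<epsilon> \<Longrightarrow> \<epsilon> < d \<Longrightarrow> \<epsilon> \<le> \<rho> \<Longrightarrow>
     S \<rho> g x - S (\<rho> - \<epsilon>) g x \<le> \<epsilon> / h * (S \<rho> G x - S \<rho> g x + \<eta>)"
proof -
  note gC = upper_Lipschitz_set_C[OF g]
  define A where "A \<epsilon> = (\<lambda>y. g y + h * ((S \<epsilon> g y - g y) / \<epsilon>))" for \<epsilon>
  define I where "I = {0<..\<rho>}"
  obtain c d0 where cd: "c \<ge> 0" "d0 > 0"
    "\<And>h x. 0 < h \<Longrightarrow> h < d0 \<Longrightarrow> S h g x \<le> g x + h * (c / \<kappa> x)"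
    using upper_Lipschitz_setE[OF g] by blast
  obtain r where r: "r \<ge> 0" "\<And>y. \<bar>g y\<bar> \<le> r / \<kappa> y" using C_spaceE[OF \<kappa>_pos gC] by blast
  have AC: "A \<epsilon> \<in> C" if "\<epsilon> \<in> I" for \<epsilon>
  proof -
    have "(\<lambda>y. h / \<epsilon> * (S \<epsilon> g y - g y)) \<in> C" using that by (intro C_scale C_diff S_C gC) (auto simp: I_def)
    from C_add[OF gC this] show ?thesis by (simp add: A_def)
  qed
  have Ab: "A \<epsilon> y \<le> (r + h * c) / \<kappa> y" if "\<epsilon> \<in> I" "dist \<epsilon> 0 < d0" for \<epsilon> y
  proof -
    have "(S \<epsilon> g y - g y) / \<epsilon> \<le> c / \<kappa> y"
      using cd(3)[of \<epsilon> y] that by (auto simp: I_def pos_divide_le_eq mult.commute)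
    then have "h * ((S \<epsilon> g y - g y) / \<epsilon>) \<le> h * (c / \<kappa> y)" using h by (intro mult_left_mono) auto
    moreover have "g y \<le> r / \<kappa> y" using r(2)[of y] by simp
    ultimately show ?thesis by (simp add: A_def add_divide_distrib)
  qed
  have An: "\<exists>d>0. \<forall>s z. s \<in> I \<longrightarrow> dist s 0 < d \<longrightarrow> dist z y < d \<longrightarrow> A s z < G y + e" if e: "e > 0" for y e
  proof -
    have "upper_Gamma_generator S g y \<le> ereal ((G y - g y) / h)" by (rule gen)
    also have "\<dots> < ereal ((G y - g y) / h + e / 2 / h)" using e h by simp
    finally obtain d1 where d1: "d1 > 0" "\<And>s z. s \<in> {0<..} \<Longrightarrow> dist s 0 < d1 \<Longrightarrow> dist z y < d1 \<Longrightarrow>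
        ereal ((S s g z - g z) / s) < ereal ((G y - g y) / h + e / 2 / h)"
      unfolding upper_Gamma_generator_def by (rule Gamma_Limsup_lessD) blast
    obtain d2 where d2: "d2 > 0" "\<And>z. dist z y < d2 \<Longrightarrow> \<bar>g z - g y\<bar> < e / 2"
      using C_continuousD[OF gC, of "e / 2" y] e by auto
    show ?thesis
    proof (intro exI[of _ "min d1 d2"] conjI allI impI)
      fix s z assume s: "s \<in> I" "dist s 0 < min d1 d2" "dist z y < min d1 d2"
      then have "(S s g z - g z) / s < (G y - g y) / h + e / 2 / h"
        using d1(2)[of s z] by (simp add: I_def)
      then have "h * ((S s g z - g z) / s) < h * ((G y - g y) / h + e / 2 / h)"
        using h by (rule mult_strict_left_mono)
      also have "\<dots> = G y - g y + e / 2" using h by (simp add: field_simps)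
      finally have "A s z < g z + (G y - g y + e / 2)" by (simp add: A_def)
      moreover have "\<bar>g z - g y\<bar> < e / 2" using d2(2)[of z] s by simp
      ultimately show "A s z < G y + e" by linarith
    qed (use d1 d2 in simp)
  qed
  have "\<exists>d>0. \<forall>\<epsilon>\<in>I. dist \<epsilon> 0 < d \<longrightarrow> S (\<rho> - \<epsilon>) (A \<epsilon>) x < S \<rho> G x + \<eta> / 2"
  proof (rule S_Gamma_usc[where \<phi> = A and x = x, OF G AC An cd(2) Ab])
    show "0 \<le> \<rho>" "\<eta> / 2 > 0" using \<rho> \<eta> by simp_all
    show "0 \<le> \<rho> - \<epsilon> \<and> dist (\<rho> - \<epsilon>) \<rho> \<le> dist \<epsilon> 0" if "\<epsilon> \<in> I" for \<epsilon>
      using that by (simp add: I_def dist_real_def)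
  qed
  then obtain d1 where d1: "d1 > 0"
      "\<And>\<epsilon>. \<epsilon> \<in> I \<Longrightarrow> dist \<epsilon> 0 < d1 \<Longrightarrow> S (\<rho> - \<epsilon>) (A \<epsilon>) x < S \<rho> G x + \<eta> / 2" by blast
  obtain K d2 where K: "K \<ge> 0" "d2 > 0"
    "\<And>\<sigma> \<epsilon>. 0 \<le> \<sigma> \<Longrightarrow> 0 \<le> \<epsilon> \<Longrightarrow> \<epsilon> < d2 \<Longrightarrow> \<sigma> + \<epsilon> \<le> \<rho> \<Longrightarrow> S (\<sigma> + \<epsilon>) g x \<le> S \<sigma> g x + K * \<epsilon>"
    using orbit_upper_Lipschitz[OF g, of \<rho> x] \<rho> by auto
  \<comment> \<open>The orbit is only upper semicontinuous in time, but \<open>S (\<rho> - \<epsilon>) g x\<close> is needed from below: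
      the Lipschitz bound provides it up to \<open>K * \<epsilon> \<le> \<eta> / 2\<close>.\<close>
  define d where "d = min (min d1 d2) (min h (\<eta> / 2 / (K + 1)))"
  show ?thesis
  proof (rule that[of d])
    show "d > 0" using d1 K h \<eta> by (simp add: d_def)
    fix \<epsilon> assume \<epsilon>: "0 < \<epsilon>" "\<epsilon> < d" "\<epsilon> \<le> \<rho>"
    have s: "0 \<le> \<rho> - \<epsilon>" using \<epsilon> by simp
    have l: "0 \<le> \<epsilon> / h" "\<epsilon> / h \<le> 1" using \<epsilon> h by (auto simp: d_def)
    have k: "(\<lambda>y. h / \<epsilon> * (S \<epsilon> g y - g y)) \<in> C" using \<epsilon> by (intro C_scale C_diff S_C gC) auto
    have "S \<rho> g x = S (\<rho> - \<epsilon>) (S \<epsilon> g) x" using S_add[OF s, of \<epsilon> g] \<epsilon> gC by simp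
    also have "S \<epsilon> g = (\<lambda>y. g y + \<epsilon> / h * (h / \<epsilon> * (S \<epsilon> g y - g y)))" using h \<epsilon> by simp
    also have "S (\<rho> - \<epsilon>) \<dots> x - S (\<rho> - \<epsilon>) g x \<le> \<epsilon> / h * (S (\<rho> - \<epsilon>) (A \<epsilon>) x - S (\<rho> - \<epsilon>) g x)"
      using S_secant[OF s gC k l, of x] by (simp add: A_def)
    also have "\<dots> \<le> \<epsilon> / h * (S \<rho> G x - S \<rho> g x + \<eta>)"
    proof (rule mult_left_mono[OF _ l(1)])
      have "S (\<rho> - \<epsilon>) (A \<epsilon>) x < S \<rho> G x + \<eta> / 2" using d1(2)[of \<epsilon>] \<epsilon> by (simp add: I_def d_def)
      moreover have "S \<rho> g x \<le> S (\<rho> - \<epsilon>) g x + K * \<epsilon>" using K(3)[of "\<rho> - \<epsilon>" \<epsilon>] \<epsilon> by (simp add: d_def)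
      moreover have "K * \<epsilon> \<le> \<eta> / 2"
      proof -
        have "\<epsilon> \<le> \<eta> / 2 / (K + 1)" using \<epsilon> by (simp add: d_def)
        then have "(K + 1) * \<epsilon> \<le> (K + 1) * (\<eta> / 2 / (K + 1))" using K(1) by (intro mult_left_mono) auto
        also have "\<dots> = \<eta> / 2" using K(1) by (simp add: field_simps)
        finally have "(K + 1) * \<epsilon> \<le> \<eta> / 2" .
        moreover have "K * \<epsilon> \<le> (K + 1) * \<epsilon>" using \<epsilon> by (intro mult_right_mono) auto
        ultimately show ?thesis by linarith
      qed
      ultimately show "S (\<rho> - \<epsilon>) (A \<epsilon>) x - S (\<rho> - \<epsilon>) g x \<le> S \<rho> G x - S \<rho> g x + \<eta>" by linarith
    qed
    finally show "S \<rho> g x - S (\<rho> - \<epsilon>) g x \<le> \<epsilon> / h * (S \<rho> G x - S \<rho> g x + \<eta>)" .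
  qed
qed

section \<open>Comparison with a supersolution\<close>

text \<open>
  The two one-sided growth bounds, on \<open>A g\<close> from above and on the quotients of \<open>w\<close> from
  below, are what bounds \<open>A g - (w h - g) / h\<close> from above, so that it has a continuous envelope.
\<close>

lemma generator_envelope:
  assumes g: "g \<in> upper_Lipschitz_set \<kappa> S" and b: "b > 0"
    and lower: "Limsup (at_right 0) (\<lambda>h. wnorm \<kappa> (neg_part (\<lambda>x. (w h x - g x) / h))) < \<infinity>"
    and gen: "Gamma_Limsup {0<..b} 0
      (\<lambda>h x. upper_Gamma_generator S g x - ereal ((w h x - g x) / h)) \<le> (\<lambda>x. 0)"
  obtains E where "\<And>n::nat. E n \<in> C" "decseq E" "\<And>x. (\<lambda>n. E n x) \<longlonglongrightarrow> 0"
    "\<And>n. \<exists>d>0. \<forall>h y. 0 < h \<longrightarrow> h < d \<longrightarrow>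
       upper_Gamma_generator S g y \<le> ereal ((w h y + h * E n y - g y) / h)"
proof -
  define A where "A = upper_Gamma_generator S g"
  have U: "A \<in> U_space \<kappa>"
    unfolding A_def using \<kappa>_cont \<kappa>_pos g by (rule upper_Gamma_generator_in_U_space)
  then obtain a where a: "a \<ge> 0" "\<And>x. \<bar>real_of_ereal (pos_part A x)\<bar> \<le> a / \<kappa> x"
    using wnorm_finiteE[where \<kappa> = \<kappa> and f = "\<lambda>x. real_of_ereal (pos_part A x)", OF \<kappa>_pos]
    unfolding U_space_def by blast
  have Afin: "A y < \<infinity>" for y using U by (simp add: U_space_def)
  have A_le: "A y \<le> ereal (a / \<kappa> y)" for y
  proof -
    have "0 \<le> a / \<kappa> y" using a(1) \<kappa>_pos[of y] by simp
    then show ?thesis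
      using a(2)[of y] Afin[of y]
      by (cases "A y") (auto simp: pos_part_def max_def split: if_splits intro: order_trans)
  qed
  obtain c d0 where c: "c \<ge> 0" "d0 > 0" "\<And>h x. 0 < h \<Longrightarrow> h < d0 \<Longrightarrow>
      \<bar>neg_part (\<lambda>x. (w h x - g x) / h) x\<bar> \<le> c / \<kappa> x"
    by (rule Limsup_wnorm_finiteE[where \<kappa> = \<kappa>, OF \<kappa>_pos lower]) blast
  \<comment> \<open>The truncation at \<open>0\<close> makes \<open>F\<close> finite where \<open>A\<close> takes the value \<open>-\<infinity>\<close>.\<close>
  define F where "F h y = real_of_ereal (max 0 (A y - ereal ((w h y - g y) / h)))" for h y
  have F: "ereal (F h y) = max 0 (A y - ereal ((w h y - g y) / h))" for h y
    using Afin[of y] by (cases "A y") (auto simp: F_def max_def)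
  have Fnear: "\<exists>d>0. \<forall>s y. s \<in> {0<..b} \<longrightarrow> dist s 0 < d \<longrightarrow> dist y x < d \<longrightarrow> F s y < e" if e: "e > 0" for x e
  proof -
    have "Gamma_Limsup {0<..b} 0 (\<lambda>h x. A x - ereal ((w h x - g x) / h)) x \<le> 0"
      using gen unfolding A_def by (rule le_funD)
    also have "0 < ereal e" using e by simp
    finally obtain d where "d > 0" "\<And>s y. s \<in> {0<..b} \<Longrightarrow> dist s 0 < d \<Longrightarrow> dist y x < d \<Longrightarrow>
      A y - ereal ((w s y - g y) / s) < ereal e" by (rule Gamma_Limsup_lessD) blast
    moreover have "F s y < e" if "A y - ereal ((w s y - g y) / s) < ereal e" for s y
    proof -
      have "ereal (F s y) < ereal e" unfolding F using that e by simp
      then show ?thesis by simp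
    qed
    ultimately show ?thesis by blast
  qed
  have Fb: "F s y \<le> (a + c) / \<kappa> y" if "s \<in> {0<..b}" "dist s 0 < d0" for s y
  proof -
    have "- ((w s y - g y) / s) \<le> c / \<kappa> y"
      using c(3)[of s y] that by (simp add: neg_part_def min_def split: if_splits)
    moreover have "0 \<le> (a + c) / \<kappa> y" using a(1) c(1) \<kappa>_pos[of y] by simp
    ultimately have "ereal (F s y) \<le> ereal ((a + c) / \<kappa> y)"
      unfolding F using A_le[of y] by (cases "A y") (auto simp: add_divide_distrib)
    then show ?thesis by simp
  qed
  obtain E where E: "\<And>n::nat. E n \<in> C" "decseq E" "\<And>x. (\<lambda>n. E n x) \<longlonglongrightarrow> 0"
      "\<And>n. \<exists>d>0. \<forall>s y. s \<in> {0<..b} \<longrightarrow> dist s 0 < d \<longrightarrow> F s y \<le> E n y"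
    using continuous_envelope[where F = F, OF \<kappa>_cont \<kappa>_pos Fnear c(2) Fb] by blast
  show ?thesis
  proof (rule that[OF E(1-3)])
    fix n
    obtain d where d: "d > 0" "\<And>s y. s \<in> {0<..b} \<Longrightarrow> dist s 0 < d \<Longrightarrow> F s y \<le> E n y" using E(4)[of n] by blast
    show "\<exists>d>0. \<forall>h y. 0 < h \<longrightarrow> h < d \<longrightarrow>
       upper_Gamma_generator S g y \<le> ereal ((w h y + h * E n y - g y) / h)"
    proof (intro exI[of _ "min d b"] conjI allI impI)
      fix h y assume h: "0 < h" "h < min d b"
      then have "F h y \<le> E n y" by (intro d(2)) auto
      then have "max 0 (A y - ereal ((w h y - g y) / h)) \<le> ereal (E n y)" by (simp add: F[symmetric])
      then have "A y - ereal ((w h y - g y) / h) \<le> ereal (E n y)" by simp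
      then have "A y \<le> ereal ((w h y - g y) / h + E n y)" by (cases "A y") auto
      also have "(w h y - g y) / h + E n y = (w h y + h * E n y - g y) / h" using h by (simp add: field_simps)
      finally show "upper_Gamma_generator S g y \<le> ereal ((w h y + h * E n y - g y) / h)" by (simp add: A_def)
    qed (use d b in simp)
  qed
qed

text \<open>
  Here \<open>w h\<close> is the value of the supersolution a time \<open>h\<close> after its value \<open>g\<close>. The claim is
  obtained for some \<open>h\<close> only, by contradiction: if it failed for all \<open>h\<close>, the mean decrease
  \<open>q\<close> of the orbit of \<open>g\<close> would satisfy, in the sense of difference quotients,
  \<open>h * q' h \<le> - \<delta> / 2\<close>, and would be unbounded above near \<open>0\<close>.
\<close>

lemma upper_right_derivative_nonneg:
  assumes g: "g \<in> upper_Lipschitz_set \<kappa> S" and \<tau>: "\<tau> > 0" and b: "b > 0"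
    and wC: "\<And>h. 0 < h \<Longrightarrow> h \<le> b \<Longrightarrow> w h \<in> C"
    and r: "r \<ge> 0" and wr: "\<And>h y. 0 < h \<Longrightarrow> h \<le> b \<Longrightarrow> \<bar>w h y\<bar> \<le> r / \<kappa> y"
    and lower: "Limsup (at_right 0) (\<lambda>h. wnorm \<kappa> (neg_part (\<lambda>x. (w h x - g x) / h))) < \<infinity>"
    and gen: "Gamma_Limsup {0<..b} 0
      (\<lambda>h x. upper_Gamma_generator S g x - ereal ((w h x - g x) / h)) \<le> (\<lambda>x. 0)"
    and \<delta>: "\<delta> > 0"
  shows "\<exists>h>0. h \<le> b \<and> h \<le> \<tau> \<and> S \<tau> g x - \<delta> * h \<le> S (\<tau> - h) (w h) x"
proof (rule ccontr)
  assume "\<not> ?thesis"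
  then have small: "S (\<tau> - h) (w h) x < S \<tau> g x - \<delta> * h" if "0 < h" "h \<le> b" "h \<le> \<tau>" for h
    using that by (meson not_le)
  note gC = upper_Lipschitz_set_C[OF g]
  obtain E where E: "\<And>n::nat. E n \<in> C" "decseq E" "\<And>x. (\<lambda>n. E n x) \<longlonglongrightarrow> 0"
    and gE: "\<And>n. \<exists>d>0. \<forall>h y. 0 < h \<longrightarrow> h < d \<longrightarrow>
       upper_Gamma_generator S g y \<le> ereal ((w h y + h * E n y - g y) / h)"
    using generator_envelope[OF g b lower gen] by blast
  have \<delta>4: "\<delta> / 4 > 0" using \<delta> by simp
  obtain N d1 where d1: "d1 > 0"
    "\<And>s f h. 0 \<le> s \<Longrightarrow> dist s \<tau> < d1 \<Longrightarrow> f \<in> C \<Longrightarrow> (\<And>y. \<bar>f y\<bar> \<le> r / \<kappa> y) \<Longrightarrow> 0 \<le> h \<Longrightarrow> h \<le> 1 \<Longrightarrow>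
      S s (\<lambda>y. f y + h * E N y) x \<le> S s f x + h * (\<delta> / 4)"
    by (rule S_perturbation[where x = x, OF E r less_imp_le[OF \<tau>] \<delta>4]) blast
  obtain d2 where d2: "d2 > 0" "\<And>h y. 0 < h \<Longrightarrow> h < d2 \<Longrightarrow>
       upper_Gamma_generator S g y \<le> ereal ((w h y + h * E N y - g y) / h)"
    using gE[of N] by blast
  obtain K d3 where K: "K \<ge> 0" "d3 > 0"
    "\<And>\<sigma> \<epsilon>. 0 \<le> \<sigma> \<Longrightarrow> 0 \<le> \<epsilon> \<Longrightarrow> \<epsilon> < d3 \<Longrightarrow> \<sigma> + \<epsilon> \<le> \<tau> \<Longrightarrow> S (\<sigma> + \<epsilon>) g x \<le> S \<sigma> g x + K * \<epsilon>"
    by (rule orbit_upper_Lipschitz[where x = x, OF g less_imp_le[OF \<tau>]]) blast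
  define m where "m = min (min d1 d2) (min (min d3 1) (min b \<tau>))"
  have m: "m > 0" using d1 d2 K b \<tau> by (simp add: m_def)
  define p where "p h = S (\<tau> - h) g x" for h
  define q where "q h = (p 0 - p h) / h" for h
  have p_step: "\<exists>d>0. \<forall>\<epsilon>. 0 < \<epsilon> \<longrightarrow> \<epsilon> < d \<longrightarrow> p h - p (h + \<epsilon>) \<le> \<epsilon> * (q h - \<delta> / 2)" if h: "0 < h" "h < m" for h
  proof -
    have hm: "h < d1" "h < d2" "h < 1" "h < b" "h < \<tau>" using h by (auto simp: m_def)
    define G where "G = (\<lambda>y. w h y + h * E N y)"
    have whC: "w h \<in> C" using wC hm h by simp
    have GC: "G \<in> C" unfolding G_def by (intro C_add C_scale E(1) whC)
    have gen': "upper_Gamma_generator S g y \<le> ereal ((G y - g y) / h)" for y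
      using d2(2)[of h y] h hm by (simp add: G_def)
    have \<rho>: "\<tau> - h > 0" using hm by simp
    have h\<delta>: "h * (\<delta> / 4) > 0" using h \<delta> by simp
    obtain d where d: "d > 0" "\<And>\<epsilon>. 0 < \<epsilon> \<Longrightarrow> \<epsilon> < d \<Longrightarrow> \<epsilon> \<le> \<tau> - h \<Longrightarrow>
       S (\<tau> - h) g x - S (\<tau> - h - \<epsilon>) g x \<le> \<epsilon> / h * (S (\<tau> - h) G x - S (\<tau> - h) g x + h * (\<delta> / 4))"
      by (rule orbit_left_derivative[where x = x, OF g GC gen' h(1) \<rho> h\<delta>]) blast
    have "S (\<tau> - h) G x \<le> S (\<tau> - h) (w h) x + h * (\<delta> / 4)"
      unfolding G_def using h hm whC wr by (intro d1(2)) (auto simp: dist_real_def)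
    also have "\<dots> < p 0 - \<delta> * h + h * (\<delta> / 4)" using small[of h] h hm by (intro add_strict_right_mono) (simp add: p_def)
    finally have "S (\<tau> - h) G x - p h + h * (\<delta> / 4) \<le> p 0 - p h - h * (\<delta> / 2)" by (simp add: algebra_simps)
    also have "\<dots> = h * (q h - \<delta> / 2)" using h by (simp add: q_def field_simps)
    finally have le: "S (\<tau> - h) G x - p h + h * (\<delta> / 4) \<le> h * (q h - \<delta> / 2)" .
    show ?thesis
    proof (intro exI[of _ "min d (\<tau> - h)"] conjI allI impI)
      fix \<epsilon> assume \<epsilon>: "0 < \<epsilon>" "\<epsilon> < min d (\<tau> - h)"
      have "p h - p (h + \<epsilon>) \<le> \<epsilon> / h * (S (\<tau> - h) G x - p h + h * (\<delta> / 4))"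
        using d(2)[of \<epsilon>] \<epsilon> by (simp add: p_def algebra_simps)
      also have "\<dots> \<le> \<epsilon> / h * (h * (q h - \<delta> / 2))"
        using le \<epsilon> h by (intro mult_left_mono) auto
      also have "\<dots> = \<epsilon> * (q h - \<delta> / 2)" using h by simp
      finally show "p h - p (h + \<epsilon>) \<le> \<epsilon> * (q h - \<delta> / 2)" .
    qed (use d \<rho> in simp)
  qed
  have p_usc: "\<forall>\<^sub>F l in at h within X. p l < p h + e" if h: "0 \<le> h" "h < \<tau>" and e: "e > 0" for h e X
  proof -
    obtain d where d: "d > 0" "\<And>s. 0 \<le> s \<Longrightarrow> dist s (\<tau> - h) < d \<Longrightarrow> S s g x < S (\<tau> - h) g x + e"
      using S_time_usc[of "\<tau> - h" g e x] h gC e by auto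
    have "p l < p h + e" if "dist l h < min d (\<tau> - h)" for l
      unfolding p_def using that by (intro d(2)) (auto simp: dist_real_def abs_less_iff)
    then show ?thesis
      unfolding eventually_at using d(1) h by (intro exI[of _ "min d (\<tau> - h)"]) auto
  qed
  \<comment> \<open>Local steps give \<open>q (h + \<epsilon>) \<le> q h - \<delta> / 2 * (\<epsilon> / (h + \<epsilon>))\<close>. On \<open>[a, 2 * a]\<close> the factor
      \<open>1 / (h + \<epsilon>)\<close> is at least \<open>1 / (2 * a)\<close>, which gives a linear rate of decrease.\<close>
  have halve: "q (2 * a) \<le> q a - \<delta> / 4" if a: "0 < a" "2 * a < m" for a
  proof -
    define \<phi> where "\<phi> h = - q h - \<delta> / 2 * (h / (2 * a))" for h
    have "\<phi> a \<le> \<phi> (2 * a)"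
    proof (rule le_by_right_steps[where \<phi> = \<phi>])
      show "a \<le> 2 * a" using a by simp
    next
      fix h y assume h: "h \<in> {a..2 * a}" and y: "\<phi> h < y"
      have hpos: "0 < h" "h < \<tau>" using h a by (auto simp: m_def)
      define e where "e = h * (y - \<phi> h) / 2"
      have e: "e > 0" using hpos y by (simp add: e_def)
      have "((\<lambda>l. (p h + e - p 0) / l - \<delta> / 2 * (l / (2 * a))) \<longlongrightarrow>
          (p h + e - p 0) / h - \<delta> / 2 * (h / (2 * a))) (at h within {a..2 * a})"
        using hpos a by (intro tendsto_intros) auto
      moreover have "(p h + e - p 0) / h - \<delta> / 2 * (h / (2 * a)) < y"
      proof -
        have mean: "(p h + e - p 0) / h = - q h + (y - \<phi> h) / 2"
          using hpos by (simp add: q_def e_def field_simps)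
        have "- q h + (y - \<phi> h) / 2 - (- q h - \<phi> h) < y" using y by (simp add: field_simps)
        then show ?thesis unfolding mean by (simp add: \<phi>_def)
      qed
      ultimately have "\<forall>\<^sub>F l in at h within {a..2 * a}. (p h + e - p 0) / l - \<delta> / 2 * (l / (2 * a)) < y"
        by (rule order_tendstoD(2))
      moreover have "\<forall>\<^sub>F l in at h within {a..2 * a}. p l < p h + e" using hpos e by (intro p_usc) auto
      moreover have "\<forall>\<^sub>F l in at h within {a..2 * a}. l \<in> {a..2 * a}"
        by (simp add: eventually_at_filter)
      ultimately show "\<forall>\<^sub>F l in at h within {a..2 * a}. \<phi> l < y"
      proof eventually_elim
        case (elim l)
        have "- q l = (p l - p 0) / l" by (simp add: q_def minus_divide_left)
        also have "\<dots> \<le> (p h + e - p 0) / l" using elim a by (intro divide_right_mono) auto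
        finally show ?case using elim(1) by (simp add: \<phi>_def)
      qed
    next
      fix h assume h: "h \<in> {a..<2 * a}"
      have hpos: "0 < h" "h < m" using h a by auto
      obtain d where d: "d > 0" "\<And>\<epsilon>. 0 < \<epsilon> \<Longrightarrow> \<epsilon> < d \<Longrightarrow> p h - p (h + \<epsilon>) \<le> \<epsilon> * (q h - \<delta> / 2)"
        using p_step[OF hpos] by blast
      define \<epsilon> where "\<epsilon> = min d (2 * a - h) / 2"
      have \<epsilon>: "0 < \<epsilon>" "\<epsilon> < d" "h + \<epsilon> \<le> 2 * a" using d h by (auto simp: \<epsilon>_def min_def field_simps)
      have "p 0 - p (h + \<epsilon>) \<le> h * q h + \<epsilon> * (q h - \<delta> / 2)"
        using d(2)[OF \<epsilon>(1,2)] hpos by (simp add: q_def)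
      also have "\<dots> = (h + \<epsilon>) * (q h - \<delta> / 2 * (\<epsilon> / (h + \<epsilon>)))"
        using hpos \<epsilon> by (simp add: field_simps)
      finally have "q (h + \<epsilon>) \<le> q h - \<delta> / 2 * (\<epsilon> / (h + \<epsilon>))"
        unfolding q_def[of "h + \<epsilon>"] using hpos \<epsilon> by (simp add: pos_divide_le_eq mult.commute)
      also have "\<dots> \<le> q h - \<delta> / 2 * (\<epsilon> / (2 * a))"
        using hpos \<epsilon> \<delta> a by (intro diff_left_mono mult_left_mono divide_left_mono) auto
      finally have "\<phi> h \<le> \<phi> (h + \<epsilon>)" by (simp add: \<phi>_def add_divide_distrib distrib_left)
      with \<epsilon> show "\<exists>\<epsilon>>0. h + \<epsilon> \<le> 2 * a \<and> \<phi> h \<le> \<phi> (h + \<epsilon>)" by blast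
    qed
    then show ?thesis using a by (simp add: \<phi>_def)
  qed
  define m' where "m' = m / 2"
  have m': "0 < m'" "m' < m" using m by (auto simp: m'_def)
  have grow: "q m' + real n * (\<delta> / 4) \<le> q (m' / 2 ^ n)" for n
  proof (induction n)
    case (Suc n)
    have "m' / 2 ^ n \<le> m'" using m' by (simp add: field_simps)
    then have "2 * (m' / 2 ^ Suc n) < m" using m' by simp
    then have "q (m' / 2 ^ n) \<le> q (m' / 2 ^ Suc n) - \<delta> / 4"
      using halve[of "m' / 2 ^ Suc n"] m' by simp
    with Suc show ?case by (simp add: algebra_simps add_divide_distrib)
  qed simp
  have q_le: "q h \<le> K" if "0 < h" "h < m" for h
    using K(3)[of "\<tau> - h" h] that by (simp add: q_def p_def m_def pos_divide_le_eq)
  obtain n :: nat where n: "(K - q m') / (\<delta> / 4) < real n" using reals_Archimedean2 by blast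
  have "K - q m' < real n * (\<delta> / 4)" using n \<delta> by (simp add: pos_divide_less_eq)
  moreover have "m' / 2 ^ n < m"
  proof -
    have "m' / 2 ^ n \<le> m'" using m' by (simp add: field_simps)
    with m' show ?thesis by simp
  qed
  ultimately show False using grow[of n] q_le[of "m' / 2 ^ n"] m' by simp
qed

end

theorem theorem3p6:
  fixes \<kappa> :: "'a::polish_space \<Rightarrow> real"
    and S :: "real \<Rightarrow> ('a \<Rightarrow> real) \<Rightarrow> ('a \<Rightarrow> real)"
    and f :: "'a \<Rightarrow> real"
    and T1 T2 :: real
    and u :: "real \<Rightarrow> 'a \<Rightarrow> real"
  assumes "continuous_on UNIV \<kappa>" and "bounded (range \<kappa>)" and "\<And>x. 0 < \<kappa> x"
    and "convex_monotone_semigroup \<kappa> S"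
    and "f \<in> upper_Lipschitz_set \<kappa> S"
    and "0 \<le> T1" and "T1 \<le> T2"
    and "\<And>t. t \<in> {T1..T2} \<Longrightarrow> u t \<in> upper_Lipschitz_set \<kappa> S"
    and "S T1 f \<le> u T1"
    and "(SUP t\<in>{T1..T2}. wnorm \<kappa> (u t)) < \<infinity>"
    and "\<And>t. t \<in> {T1..T2} \<Longrightarrow>
           Gamma_Limsup {T1..T2} t (\<lambda>s x. ereal (u s x)) \<le> (\<lambda>x. ereal (u t x))"
    and "\<And>t. t \<in> {T1..<T2} \<Longrightarrow>
           Limsup (at_right 0) (\<lambda>h. wnorm \<kappa> (neg_part (\<lambda>x. (u (t + h) x - u t x) / h))) < \<infinity>"
    and "\<And>t. t \<in> {T1..<T2} \<Longrightarrow>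
           Gamma_Limsup {0<..T2 - t} 0
             (\<lambda>h x. upper_Gamma_generator S (u t) x - ereal ((u (t + h) x - u t x) / h)) \<le> (\<lambda>x. 0)"
  shows "\<forall>t\<in>{T1..T2}. S t f \<le> u t"
proof (intro ballI le_funI)
  fix T x assume T: "T \<in> {T1..T2}"
  interpret convex_semigroup \<kappa> S using assms(1,3,4) by unfold_locales
  have uC: "u t \<in> C" if "t \<in> {T1..T2}" for t using upper_Lipschitz_set_C[OF assms(8)[OF that]] .
  have fC: "f \<in> C" by (rule upper_Lipschitz_set_C[OF assms(5)])
  obtain n :: nat where "(SUP t\<in>{T1..T2}. wnorm \<kappa> (u t)) < ereal (real n)"
    using assms(10) less_PInf_Ex_of_nat by auto
  then have "wnorm \<kappa> (u t) \<le> ereal (real n)" if "t \<in> {T1..T2}" for t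
    using that by (intro order_trans[OF SUP_upper less_imp_le]) auto
  then have ub: "\<bar>u t y\<bar> \<le> real n / \<kappa> y" if "t \<in> {T1..T2}" for t y
    using that wnorm_le_iff[of \<kappa> "u t" "real n"] \<kappa>_pos by simp
  define v where "v s = S (T - s) (u s) x" for s
  \<comment> \<open>The slope \<open>\<delta>\<close> is added to \<open>v\<close> to turn the steps \<open>v (s + h) \<ge> v s - \<delta> * h\<close> into
      nondecreasing ones.\<close>
  have mono: "v T1 \<le> v T + \<delta> * (T - T1)" if \<delta>: "\<delta> > 0" for \<delta>
  proof -
    have "v T1 + \<delta> * T1 \<le> v T + \<delta> * T"
    proof (rule le_by_right_steps[where \<phi> = "\<lambda>s. v s + \<delta> * s"])
      show "T1 \<le> T" using T by simp
    next
      fix s y assume s: "s \<in> {T1..T}" and y: "v s + \<delta> * s < y"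
      have sT: "s \<in> {T1..T2}" using s T by simp
      define \<eta> where "\<eta> = (y - (v s + \<delta> * s)) / 2"
      have \<eta>: "\<eta> > 0" using y by (simp add: \<eta>_def)
      have near: "\<exists>d>0. \<forall>l z. l \<in> {T1..T} \<longrightarrow> dist l s < d \<longrightarrow> dist z y < d \<longrightarrow> u l z < u s y + e"
        if e: "e > 0" for y e
      proof -
        have "Gamma_Limsup {T1..T2} s (\<lambda>s x. ereal (u s x)) y \<le> ereal (u s y)"
          using assms(11)[OF sT] by (rule le_funD)
        also have "\<dots> < ereal (u s y + e)" using e by simp
        finally obtain d where "d > 0" "\<And>l z. l \<in> {T1..T2} \<Longrightarrow> dist l s < d \<Longrightarrow> dist z y < d \<Longrightarrow>
          ereal (u l z) < ereal (u s y + e)" by (rule Gamma_Limsup_lessD) blast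
        then show ?thesis using T by (intro exI[of _ d]) auto
      qed
      have "\<exists>d>0. \<forall>l\<in>{T1..T}. dist l s < d \<longrightarrow> S (T - l) (u l) x < S (T - s) (u s) x + \<eta>"
      proof (rule S_Gamma_usc[where \<phi> = u and x = x, OF uC[OF sT] _ near zero_less_one _ _ _ \<eta>])
        show "u l \<in> C" if "l \<in> {T1..T}" for l using that T by (intro uC) simp
        show "u l z \<le> real n / \<kappa> z" if "l \<in> {T1..T}" for l z
          using ub[of l z] that T by simp
        show "0 \<le> T - s" using s by simp
        show "0 \<le> T - l \<and> dist (T - l) (T - s) \<le> dist l s" if "l \<in> {T1..T}" for l
          using that by (simp add: dist_real_def)
      qed
      then obtain d where d: "d > 0"
        "\<And>l. l \<in> {T1..T} \<Longrightarrow> dist l s < d \<Longrightarrow> S (T - l) (u l) x < S (T - s) (u s) x + \<eta>" by blast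
      show "\<forall>\<^sub>F l in at s within {T1..T}. v l + \<delta> * l < y"
        unfolding eventually_at
      proof (intro exI[of _ "min d (\<eta> / \<delta>)"] conjI ballI impI)
        fix l assume l: "l \<in> {T1..T}" "l \<noteq> s \<and> dist l s < min d (\<eta> / \<delta>)"
        have "v l < v s + \<eta>" unfolding v_def using d(2) l by simp
        moreover have "l - s < \<eta> / \<delta>" using l(2) by (auto simp: dist_real_def)
        then have "\<delta> * (l - s) < \<eta>" using \<delta> by (simp add: pos_less_divide_eq mult.commute)
        moreover have "y = v s + \<delta> * s + 2 * \<eta>" by (simp add: \<eta>_def field_simps)
        moreover have "\<delta> * l = \<delta> * s + \<delta> * (l - s)" by (simp add: algebra_simps)
        ultimately show "v l + \<delta> * l < y" by linarith
      qed (use d \<eta> \<delta> in simp)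
    next
      fix s assume s: "s \<in> {T1..<T}"
      have sT: "s \<in> {T1..<T2}" "s \<in> {T1..T2}" "T - s > 0" "T2 - s > 0" using s T by auto
      have "\<exists>h>0. h \<le> T2 - s \<and> h \<le> T - s \<and>
          S (T - s) (u s) x - \<delta> * h \<le> S (T - s - h) (u (s + h)) x"
        using sT(1) by (intro upper_right_derivative_nonneg[where r = "real n"] assms(8,12,13) sT uC ub \<delta>) auto
      then obtain h where h: "h > 0" "h \<le> T - s" "v s - \<delta> * h \<le> v (s + h)"
        by (auto simp: v_def diff_diff_eq)
      then show "\<exists>h>0. s + h \<le> T \<and> v s + \<delta> * s \<le> v (s + h) + \<delta> * (s + h)"
        by (intro exI[of _ h]) (auto simp: algebra_simps)
    qed
    then show ?thesis by (simp add: algebra_simps)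
  qed
  have le: "v T1 \<le> v T + e" if "e > 0" for e
  proof -
    have "v T1 \<le> v T + e / (T - T1 + 1) * (T - T1)" using T that by (intro mono) simp
    also have "e / (T - T1 + 1) * (T - T1) \<le> e / (T - T1 + 1) * (T - T1 + 1)"
      using T that by (intro mult_left_mono) auto
    also have "\<dots> = e" using T by simp
    finally show ?thesis by simp
  qed
  have "S T f x = S (T - T1) (S T1 f) x"
    using S_add[of "T - T1" T1 f] T assms(6) fC by simp
  also have "\<dots> \<le> v T1"
    unfolding v_def using T assms(6,7,9) by (intro S_mono S_C fC uC) (auto simp: le_fun_def)
  also have "\<dots> \<le> v T" using le by (rule field_le_epsilon)
  also have "v T = u T x" using S_0[OF uC[OF T]] by (simp add: v_def)
  finally show "S T f x \<le> u T x" .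
qed

end
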